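(* Let $W$ be a Coxeter group with (finite) Coxeter generating set $S$. Then its standard language $\mathcal L\subset S^*$ is regular.
   Context: A Coxeter group $W$ is a group generated by a finite set $S$ subject only to the relations $s^2=1$ for $s\in S$ and $(st)^{m_{st}}=1$ for $s\neq t\in S$, where $m_{st}=m_{ts}\in\{2,3,\ldots,\infty\}$ and $m_{st}=\infty$ means that no relation is imposed between $s$ and $t$. $\ell(g)$ denotes the word length of $g\in W$ with respect to $S$, and $S^*$ is the set of all words over $S$. For $v\in S^*$ of length $n$, $v(i)$ denotes the prefix of $v$ of length $i$ ($i\le n$), and for $1\le i\le j\le n$, $v(i,j)$ denotes the subword of $v(j)$ obtained by removing the prefix $v(i-1)$. **Standard language.** For $g\in W$ let $T(g)\subseteq S$ be the set of $s\in S$ with $\ell(gs)<\ell(g)$. The group $\langle T(g)\rangle$ is finite; let $w(g)$ be its (unique) longest element, and let $\Pi(g)=gw(g)$. One has $\ell(\Pi(g))+\ell(w(g))=\ell(g)$. The standard language $\mathcal L\subset S^*$ for $W$ is defined inductively: a word $v$ representing the identity belongs to $\mathcal L$ if and only if it is empty; a word $v$ of length $n$ representing $g\ne\mathrm{id}$ belongs to $\mathcal L$ if and only if, for $k=\ell(w(g))$, we have $v(n-k)\in\mathcal L$ and $v(n-k+1,n)$ represents $w(g)$. **Regular languages.** A finite state automaton (FSA) over $S$ is a finite directed graph $\Gamma$ with vertex set $V$, edge set $E\subseteq V\times V$, an edge labelling $\phi\colon E\to\mathcal P(S^* )$ (the power set of $S^*$; in the construction used the label sets are finite), a set of start states $S_0\subseteq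 V$ and a set of accept states $F\subseteq V$. A word $v$ is accepted by $\Gamma$ if there are a decomposition $v=v_0\cdots v_m$ into subwords and an edge-path $e_0\cdots e_m$ in $\Gamma$ with $e_0$ starting in $S_0$, $e_m$ ending in $F$, and $v_i\in\phi(e_i)$ for all $i$. A subset of $S^*$ is a regular language if it is the set of words accepted by some FSA over $S$; this is to be understood as the usual notion of regular language. *)

theory Defs
  imports "HOL-Algebra.Generated_Groups" "HOL-Library.Extended_Nat"
begin

text \<open>Elements of the free group on \<open>S\<close> are represented by words over \<open>S \<times> UNIV\<close>, where
  \<open>(s, True)\<close> stands for \<open>s\<close> and \<open>(s, False)\<close> for the formal inverse of \<open>s\<close>.\<close>

type_synonym 'a signed_word = "('a \<times> bool) list"

text \<open>Equality in the group \<open>\<langle>S | R\<rangle>\<close>: the congruence on signed words generated by free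
  cancellation and by deletion of relators.\<close>

inductive pres_eq :: "'a set \<Rightarrow> 'a signed_word set \<Rightarrow> 'a signed_word \<Rightarrow> 'a signed_word \<Rightarrow> bool"
  for S :: "'a set" and R :: "'a signed_word set"
  where
    refl: "u \<in> lists (S \<times> UNIV) \<Longrightarrow> pres_eq S R u u"
  | sym: "pres_eq S R u v \<Longrightarrow> pres_eq S R v u"
  | trans: "pres_eq S R u v \<Longrightarrow> pres_eq S R v w \<Longrightarrow> pres_eq S R u w"
  | cancel: "u \<in> lists (S \<times> UNIV) \<Longrightarrow> v \<in> lists (S \<times> UNIV) \<Longrightarrow> s \<in> S \<Longrightarrow>
      pres_eq S R (u @ [(s, b), (s, \<not> b)] @ v) (u @ v)"
  | relator: "u \<in> lists (S \<times> UNIV) \<Longrightarrow> v \<in> lists (S \<times> UNIV) \<Longrightarrow> r \<in> R \<Longrightarrow>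
      pres_eq S R (u @ r @ v) (u @ v)"

definition word_val :: "('a, 'b) monoid_scheme \<Rightarrow> 'a list \<Rightarrow> 'a" where
  "word_val G v = foldr (\<lambda>x y. x \<otimes>\<^bsub>G\<^esub> y) v \<one>\<^bsub>G\<^esub>"

definition signed_val :: "('a, 'b) monoid_scheme \<Rightarrow> 'a signed_word \<Rightarrow> 'a" where
  "signed_val G v = word_val G (map (\<lambda>(s, b). if b then s else inv\<^bsub>G\<^esub> s) v)"

definition has_presentation ::
    "('a, 'b) monoid_scheme \<Rightarrow> 'a set \<Rightarrow> 'a signed_word set \<Rightarrow> bool" where
  "has_presentation G S R \<longleftrightarrow>
     group G \<and> S \<subseteq> carrier G \<and> generate G S = carrier G \<and> R \<subseteq> lists (S \<times> UNIV) \<and>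
     (\<forall>u \<in> lists (S \<times> UNIV). \<forall>v \<in> lists (S \<times> UNIV).
        signed_val G u = signed_val G v \<longleftrightarrow> pres_eq S R u v)"

text \<open>Pairs with \<open>m s t = \<infinity>\<close> contribute no relator; the values \<open>m s s\<close> are irrelevant.\<close>

definition coxeter_relators :: "'a set \<Rightarrow> ('a \<Rightarrow> 'a \<Rightarrow> enat) \<Rightarrow> 'a signed_word set" where
  "coxeter_relators S m =
     {[(s, True), (s, True)] | s. s \<in> S} \<union>
     {concat (replicate k [(s, True), (t, True)]) | s t k.
        s \<in> S \<and> t \<in> S \<and> s \<noteq> t \<and> m s t = enat k}"

definition coxeter_system ::
    "('a, 'b) monoid_scheme \<Rightarrow> 'a set \<Rightarrow> ('a \<Rightarrow> 'a \<Rightarrow> enat) \<Rightarrow> bool" where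
  "coxeter_system G S m \<longleftrightarrow>
     finite S \<and>
     (\<forall>s\<in>S. \<forall>t\<in>S. s \<noteq> t \<longrightarrow> m s t = m t s \<and> 2 \<le> m s t) \<and>
     has_presentation G S (coxeter_relators S m)"

definition word_length :: "('a, 'b) monoid_scheme \<Rightarrow> 'a set \<Rightarrow> 'a \<Rightarrow> nat" where
  "word_length G S g = (LEAST n. \<exists>v \<in> lists S. length v = n \<and> word_val G v = g)"

definition right_descents :: "('a, 'b) monoid_scheme \<Rightarrow> 'a set \<Rightarrow> 'a \<Rightarrow> 'a set" where
  "right_descents G S g = {s \<in> S. word_length G S (g \<otimes>\<^bsub>G\<^esub> s) < word_length G S g}"

text \<open>The longest element \<open>w(g)\<close> of \<open>\<langle>T(g)\<rangle>\<close>, where \<open>T(g)\<close> is the set of right descents of \<open>g\<close>.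
  In a Coxeter group \<open>\<langle>T(g)\<rangle>\<close> is finite and has exactly one longest element.\<close>

definition longest_descent :: "('a, 'b) monoid_scheme \<Rightarrow> 'a set \<Rightarrow> 'a \<Rightarrow> 'a" where
  "longest_descent G S g =
     (THE x. x \<in> generate G (right_descents G S g) \<and>
        (\<forall>y \<in> generate G (right_descents G S g). word_length G S y \<le> word_length G S x))"

text \<open>For \<open>g \<noteq> 1\<close> one has \<open>k > 0\<close>, so membership of \<open>v\<close> only refers to membership of a
  strictly shorter word and the least fixed point is the recursively defined language. No nonempty
  word representing the identity belongs to it.\<close>

inductive_set standard_language :: "('a, 'b) monoid_scheme \<Rightarrow> 'a set \<Rightarrow> 'a list set"
  for G :: "('a, 'b) monoid_scheme" and S :: "'a set"
  where
    empty: "[] \<in> standard_language G S"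
  | step: "\<lbrakk>v \<in> lists S; g = word_val G v; g \<noteq> \<one>\<^bsub>G\<^esub>;
      n = length v; k = word_length G S (longest_descent G S g); k \<le> n;
      take (n - k) v \<in> standard_language G S;
      word_val G (drop (n - k) v) = longest_descent G S g\<rbrakk>
     \<Longrightarrow> v \<in> standard_language G S"

record ('v, 'a) fsa =
  fsa_verts :: "'v set"
  fsa_edges :: "('v \<times> 'v) set"
  fsa_label :: "'v \<times> 'v \<Rightarrow> 'a list set"
  fsa_start :: "'v set"
  fsa_accept :: "'v set"

text \<open>Edges carry sets of words, not single letters. These sets are required to be finite:
  with arbitrary label sets every language would be accepted by a one-edge automaton.\<close>

definition is_fsa :: "'a set \<Rightarrow> ('v, 'a) fsa \<Rightarrow> bool" where
  "is_fsa S A \<longleftrightarrow>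
     finite (fsa_verts A) \<and>
     fsa_edges A \<subseteq> fsa_verts A \<times> fsa_verts A \<and>
     (\<forall>e \<in> fsa_edges A. fsa_label A e \<subseteq> lists S \<and> finite (fsa_label A e)) \<and>
     fsa_start A \<subseteq> fsa_verts A \<and> fsa_accept A \<subseteq> fsa_verts A"

definition edge_path :: "('v, 'a) fsa \<Rightarrow> ('v \<times> 'v) list \<Rightarrow> bool" where
  "edge_path A es \<longleftrightarrow>
     es \<noteq> [] \<and> set es \<subseteq> fsa_edges A \<and>
     (\<forall>i. Suc i < length es \<longrightarrow> snd (es ! i) = fst (es ! Suc i))"

definition fsa_language :: "('v, 'a) fsa \<Rightarrow> 'a list set" where
  "fsa_language A =
     {concat vs | vs es. edge_path A es \<and>
        fst (hd es) \<in> fsa_start A \<and> snd (last es) \<in> fsa_accept A \<and>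
        length vs = length es \<and> (\<forall>i < length es. vs ! i \<in> fsa_label A (es ! i))}"

text \<open>As vertex sets are finite, taking the vertices to be natural numbers is no restriction.\<close>

definition regular_language :: "'a set \<Rightarrow> 'a list set \<Rightarrow> bool" where
  "regular_language S L \<longleftrightarrow> (\<exists>A :: (nat, 'a) fsa. is_fsa S A \<and> L = fsa_language A)"

end

(* A Coxeter group acts on its geometric representation, and lengths are read off from the signs of
   roots: g s is shorter than g iff g maps the simple root of s to a negative root. Two elements g, h
   satisfy l(g h) = l(g) + l(h) unless some positive root is made negative by both g and h^-1, and
   by passing to a dominated root it suffices to test the small roots, i.e. the positive roots that
   dominate no other positive root. By Brink and Howlett there are only finitely many small roots, so there
   are only finitely many cone types {h. l(g h) = l(g) + l(h)}. The cone type of g determines the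
   descents of g, hence the longest element w of the group they generate, and the cone type of g h
   for every h in the cone type of g. So cone types serve as states of an automaton, whose edges read
   reduced words of the elements w. *)
theory Submission
  imports Defs Complex_Main
begin

text \<open>The substance is the finiteness of \<open>small_roots\<close>. Distinct small roots pair
  to less than 1, because a pairing of at least 1 would give some group element infinitely many
  inversions unless one root dominated the other. Reflecting in simple roots of positive pairing
  leads a small root down to a simple one, through small roots only. The obstacle is to bound the
  number of these steps: pairings strictly between -1 and 1 must be shown to take finitely many
  values, and nothing bounds the pairings below -1. Two roots whose pairing lies strictly between -1
  and 1 are carried by one group element into a subsystem of finitely many roots supported on some J
  \<subseteq> S, and S has finitely many subsets. The pairings below -1 are truncated, and the
  truncated pairings with all simple roots turn out never to repeat along a descent. Every infinite
  family of roots is excluded by the same fact, that a group element has only finitely many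
  inversions; it takes the place of a topological argument about discreteness.\<close>

locale coxeter =
  fixes G :: "('a, 'b) monoid_scheme" (structure) and S :: "'a set" and m :: "'a \<Rightarrow> 'a \<Rightarrow> enat"
  assumes coxeter_system: "coxeter_system G S m"
begin

lemma finite_S: "finite S"
  using coxeter_system by (simp add: coxeter_system_def)

lemma presentation: "has_presentation G S (coxeter_relators S m)"
  using coxeter_system by (simp add: coxeter_system_def)

lemma m_sym: "s \<in> S \<Longrightarrow> t \<in> S \<Longrightarrow> s \<noteq> t \<Longrightarrow> m s t = m t s"
  using coxeter_system unfolding coxeter_system_def by blast

lemma m_ge_2: "s \<in> S \<Longrightarrow> t \<in> S \<Longrightarrow> s \<noteq> t \<Longrightarrow> m s t = enat k \<Longrightarrow> 2 \<le> k"
  using coxeter_system unfolding coxeter_system_def by (metis enat_ord_simps(1) numeral_eq_enat)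

end

sublocale coxeter \<subseteq> group G
  using presentation by (simp add: has_presentation_def)

context coxeter
begin

section \<open>Words and length\<close>

lemma S_carrier: "S \<subseteq> carrier G"
  using presentation by (simp add: has_presentation_def)

lemma S_closed [simp]: "s \<in> S \<Longrightarrow> s \<in> carrier G"
  using S_carrier by blast

lemma generate_S: "generate G S = carrier G"
  using presentation by (simp add: has_presentation_def)

abbreviation val :: "'a list \<Rightarrow> 'a" where "val \<equiv> word_val G"
abbreviation len :: "'a \<Rightarrow> nat" where "len \<equiv> word_length G S"

lemma val_Nil [simp]: "val [] = \<one>"
  and val_Cons [simp]: "val (x # v) = x \<otimes> val v"
  by (simp_all add: word_val_def)

lemma val_closed [simp]: "set v \<subseteq> S \<Longrightarrow> val v \<in> carrier G"
  by (induction v) auto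

lemma val_append [simp]: "set u \<subseteq> S \<Longrightarrow> set v \<subseteq> S \<Longrightarrow> val (u @ v) = val u \<otimes> val v"
  by (induction u) (auto simp: m_assoc)

abbreviation unsigned :: "'a list \<Rightarrow> 'a signed_word" where
  "unsigned \<equiv> map (\<lambda>s. (s, True))"

lemma signed_val_unsigned: "signed_val G (unsigned v) = val v"
  by (simp add: signed_val_def comp_def)

lemma unsigned_lists: "set v \<subseteq> S \<Longrightarrow> unsigned v \<in> lists (S \<times> UNIV)"
  by (induction v) auto

lemma val_eq_imp_pres_eq:
  assumes "set u \<subseteq> S" "set v \<subseteq> S" "val u = val v"
  shows "pres_eq S (coxeter_relators S m) (unsigned u) (unsigned v)"
  using presentation assms unsigned_lists[of u] unsigned_lists[of v]
  unfolding has_presentation_def by (metis signed_val_unsigned)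

lemma relator_val:
  assumes "unsigned r \<in> coxeter_relators S m"
  shows "val r = \<one>"
proof -
  have r: "unsigned r \<in> lists (S \<times> UNIV)"
    using presentation assms unfolding has_presentation_def by blast
  have "pres_eq S (coxeter_relators S m) ([] @ unsigned r @ []) ([] @ [])"
    by (rule pres_eq.relator) (use assms in auto)
  then have "signed_val G (unsigned r) = signed_val G []"
    using presentation r unfolding has_presentation_def by (metis append_Nil append_Nil2 lists.Nil)
  then show ?thesis
    using signed_val_unsigned[of "[]"] by (simp add: signed_val_unsigned)
qed

lemma S_involution [simp]: "s \<in> S \<Longrightarrow> s \<otimes> s = \<one>"
  using relator_val[of "[s, s]"] by (auto simp: coxeter_relators_def)

lemma S_inv [simp]: "s \<in> S \<Longrightarrow> inv s = s"
  by (simp add: inv_equality)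

lemma S_cancel_right [simp]: "g \<in> carrier G \<Longrightarrow> s \<in> S \<Longrightarrow> g \<otimes> s \<otimes> s = g"
  by (simp add: m_assoc)

lemma braid_val:
  assumes "s \<in> S" "t \<in> S" "s \<noteq> t" "m s t = enat k"
  shows "val (concat (replicate k [s, t])) = \<one>"
proof (rule relator_val)
  have "unsigned (concat (replicate k [s, t])) = concat (replicate k [(s, True), (t, True)])"
    by (simp add: map_concat)
  then show "unsigned (concat (replicate k [s, t])) \<in> coxeter_relators S m"
    using assms by (auto simp: coxeter_relators_def)
qed

lemma generate_words:
  assumes "T \<subseteq> S" "g \<in> generate G T"
  shows "\<exists>v. set v \<subseteq> T \<and> val v = g"
  using assms(2)
proof induction
  case one
  show ?case by (rule exI[of _ "[]"]) auto
next
  case (incl h)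
  then show ?case using assms(1) by (intro exI[of _ "[h]"]) auto
next
  case (inv h)
  then show ?case using assms(1) by (intro exI[of _ "[h]"]) auto
next
  case (eng h1 h2)
  then obtain u v where "set u \<subseteq> T" "set v \<subseteq> T" "val u = h1" "val v = h2" by blast
  then show ?case using assms(1) val_append[of u v] by (intro exI[of _ "u @ v"]) auto
qed

lemma ex_word: "g \<in> carrier G \<Longrightarrow> \<exists>v. set v \<subseteq> S \<and> val v = g"
  using generate_words[of S g] generate_S by auto

lemma inv_val: "set v \<subseteq> S \<Longrightarrow> inv (val v) = val (rev v)"
  by (induction v) (auto simp: inv_mult_group val_append)

lemma len_le: "set v \<subseteq> S \<Longrightarrow> len (val v) \<le> length v"
  unfolding word_length_def by (rule Least_le) (auto simp: lists_eq_set)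

lemma ex_reduced:
  assumes "g \<in> carrier G"
  obtains v where "set v \<subseteq> S" "val v = g" "length v = len g"
proof -
  have "\<exists>v. set v \<subseteq> S \<and> length v = len g \<and> val v = g"
    using LeastI_ex[of "\<lambda>n. \<exists>v \<in> lists S. length v = n \<and> word_val G v = g"] ex_word[OF assms]
    unfolding word_length_def by (auto simp: lists_eq_set)
  then show ?thesis using that by blast
qed

lemma len_one [simp]: "len \<one> = 0"
  using len_le[of "[]"] by simp

lemma len_eq_0: "g \<in> carrier G \<Longrightarrow> len g = 0 \<longleftrightarrow> g = \<one>"
  by (metis ex_reduced len_one length_0_conv val_Nil)

lemma len_mult: "g \<in> carrier G \<Longrightarrow> h \<in> carrier G \<Longrightarrow> len (g \<otimes> h) \<le> len g + len h"
proof -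
  assume "g \<in> carrier G" "h \<in> carrier G"
  then obtain u v where "set u \<subseteq> S" "val u = g" "length u = len g"
    "set v \<subseteq> S" "val v = h" "length v = len h" by (metis ex_reduced)
  then show ?thesis using len_le[of "u @ v"] by simp
qed

lemma len_S: "s \<in> S \<Longrightarrow> len s \<le> 1"
  using len_le[of "[s]"] by simp

lemma len_mult_S_le: "g \<in> carrier G \<Longrightarrow> s \<in> S \<Longrightarrow> len (g \<otimes> s) \<le> len g + 1"
  using len_mult[of g s] len_S[of s] by simp

text \<open>All relators have even length, so parity of word length is an invariant of the group
  element. This is what excludes \<open>len (g \<otimes> s) = len g\<close>.\<close>

lemma pres_eq_parity:
  "pres_eq S (coxeter_relators S m) u v \<Longrightarrow> even (length u) = even (length v)"
proof (induction rule: pres_eq.induct)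
  case (relator u v r)
  then have "even (length r)"
    by (auto simp: coxeter_relators_def length_concat sum_list_replicate)
  then show ?case by simp
qed auto

lemma even_len: "set v \<subseteq> S \<Longrightarrow> even (len (val v)) = even (length v)"
proof -
  assume v: "set v \<subseteq> S"
  then obtain u where "set u \<subseteq> S" "val u = val v" "length u = len (val v)"
    using ex_reduced[of "val v"] by auto
  then show ?thesis
    using pres_eq_parity[OF val_eq_imp_pres_eq[of u v]] v by simp
qed

lemma len_mult_S_neq:
  assumes "g \<in> carrier G" "s \<in> S"
  shows "len (g \<otimes> s) \<noteq> len g"
proof -
  obtain v where v: "set v \<subseteq> S" "val v = g" using ex_word assms(1) by blast
  then have "val (v @ [s]) = g \<otimes> s" using assms by simp
  then have "even (len (g \<otimes> s)) = even (length (v @ [s]))"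
    using even_len[of "v @ [s]"] v(1) assms(2) by auto
  then show ?thesis using even_len[OF v(1)] v(2) by auto
qed

lemma len_mult_S_cases:
  assumes "g \<in> carrier G" "s \<in> S"
  shows "len (g \<otimes> s) = len g + 1 \<or> len g = len (g \<otimes> s) + 1"
  using len_mult_S_le[OF assms] len_mult_S_le[of "g \<otimes> s" s] len_mult_S_neq[OF assms] assms
  by fastforce

lemma ex_descent:
  assumes "g \<in> carrier G" "g \<noteq> \<one>"
  shows "\<exists>s \<in> S. len (g \<otimes> s) < len g"
proof -
  obtain v where v: "set v \<subseteq> S" "val v = g" "length v = len g" using ex_reduced assms(1) by blast
  then have "v \<noteq> []" using assms(2) by auto
  then obtain u s where us: "v = u @ [s]" by (metis append_butlast_last_id)
  then have "s \<in> S" "set u \<subseteq> S" using v(1) by auto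
  moreover from this have "g \<otimes> s = val u" using v(2) us S_cancel_right[of "val u" s] by simp
  ultimately show ?thesis using len_le[of u] v(3) us by (intro bexI[of _ s]) auto
qed

lemma len_inv: 
  assumes "g \<in> carrier G" shows "len (inv g) = len g"
proof -
  have *: "len (inv h) \<le> len h" if h: "h \<in> carrier G" for h
  proof -
    obtain v where "set v \<subseteq> S" "val v = h" "length v = len h" using ex_reduced[OF h] by blast
    then show ?thesis using len_le[of "rev v"] inv_val[of v] by simp
  qed
  show ?thesis using *[of g] *[of "inv g"] assms by simp
qed

end

section \<open>The geometric representation\<close>

text \<open>Chebyshev polynomials of the second kind with shifted index, U_(k-1)(c). They are the
  coordinates of a simple root after alternating reflections.\<close>

fun cheb :: "real \<Rightarrow> nat \<Rightarrow> real" where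
  "cheb c 0 = 0"
| "cheb c (Suc 0) = 1"
| "cheb c (Suc (Suc k)) = 2 * c * cheb c (Suc k) - cheb c k"

lemma cheb_cos: "sin x * cheb (cos x) k = sin (real k * x)"
proof (induction "cos x" k rule: cheb.induct)
  case (3 k)
  have "sin x * cheb (cos x) (Suc (Suc k)) = 2 * cos x * sin (real (Suc k) * x) - sin (real k * x)"
    using 3 by (simp add: algebra_simps)
  also have "\<dots> = sin (real (Suc (Suc k)) * x)"
  proof -
    have "real (Suc (Suc k)) * x = real (Suc k) * x + x" "real k * x = real (Suc k) * x - x"
      by (simp_all add: algebra_simps)
    then show ?thesis by (simp only: sin_add sin_diff) simp
  qed
  finally show ?case .
qed auto

lemma cheb_one: "cheb 1 k = real k"
  by (induction "1::real" k rule: cheb.induct) auto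

text \<open>All linear combinations go through this binary operation, so that linearity of a map is
  a single equation; multiples are written with a dummy second summand.\<close>

definition lc :: "real \<Rightarrow> ('a \<Rightarrow> real) \<Rightarrow> real \<Rightarrow> ('a \<Rightarrow> real) \<Rightarrow> 'a \<Rightarrow> real" where
  "lc p u q v = (\<lambda>x. p * u x + q * v x)"

lemma lc_apply [simp]: "lc p u q v x = p * u x + q * v x"
  by (simp add: lc_def)

text \<open>The zero vector is both \<open>pos\<close> and \<open>neg\<close>; for roots the two
  exclude each other, by \<open>root_sign\<close>.\<close>

definition pos :: "('a \<Rightarrow> real) \<Rightarrow> bool" where "pos v \<longleftrightarrow> (\<forall>x. 0 \<le> v x)"
definition neg :: "('a \<Rightarrow> real) \<Rightarrow> bool" where "neg v \<longleftrightarrow> (\<forall>x. v x \<le> 0)"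

lemma neg_uminus [simp]: "neg (\<lambda>x. - v x) \<longleftrightarrow> pos v"
  and pos_uminus [simp]: "pos (\<lambda>x. - v x) \<longleftrightarrow> neg v"
  by (simp_all add: pos_def neg_def)

definition simple :: "'a \<Rightarrow> 'a \<Rightarrow> real" where
  "simple s = (\<lambda>x. if x = s then 1 else 0)"

text \<open>Grows at the front, so the last letter stays \<open>t\<close>; as words act from the
  right, one more letter is one more reflection.\<close>

primrec alt_word :: "'a \<Rightarrow> 'a \<Rightarrow> nat \<Rightarrow> 'a list" where
  "alt_word s t 0 = []"
| "alt_word s t (Suc k) = (if even k then t else s) # alt_word s t k"

lemma length_alt_word [simp]: "length (alt_word s t k) = k"
  by (induction k) auto

lemma set_alt_word: "set (alt_word s t k) \<subseteq> {s, t}"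
  by (induction k) auto

lemma alt_word_snoc: "alt_word s t (Suc k) = alt_word t s k @ [t]"
  by (induction k) auto

lemma alt_word_double: "alt_word s t (2 * k) = concat (replicate k [s, t])"
  by (induction k) auto

lemma alt_word_add: "\<exists>z. length z = i \<and> set z \<subseteq> {s, t} \<and> alt_word s t (i + j) = z @ alt_word s t j"
proof (induction i)
  case (Suc i)
  then obtain z where "length z = i" "set z \<subseteq> {s, t}" "alt_word s t (i + j) = z @ alt_word s t j" by blast
  then show ?case by (intro exI[of _ "(if even (i + j) then t else s) # z"]) auto
qed auto

context coxeter
begin

text \<open>The Gram matrix of the simple roots: \<open>s\<close> and \<open>t\<close> enclose the
  angle pi - pi / m, and -1 is the limit for m = \<infinity>.\<close>

definition cos_entry :: "'a \<Rightarrow> 'a \<Rightarrow> real" where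
  "cos_entry s t = (if s = t then 1 else case m s t of enat k \<Rightarrow> - cos (pi / real k) | \<infinity> \<Rightarrow> - 1)"

lemma cos_entry_self [simp]: "cos_entry s s = 1"
  by (simp add: cos_entry_def)

lemma cos_entry_sym: "s \<in> S \<Longrightarrow> t \<in> S \<Longrightarrow> cos_entry s t = cos_entry t s"
  using m_sym by (auto simp: cos_entry_def)

lemma cos_entry_nonpos:
  assumes "s \<in> S" "t \<in> S" "s \<noteq> t"
  shows "cos_entry s t \<le> 0"
proof (cases "m s t")
  case (enat k)
  then have "2 \<le> real k" using m_ge_2[OF assms] by simp
  then have "pi / real k \<le> pi / 2" by (intro divide_left_mono) auto
  then have "0 \<le> cos (pi / real k)" using pi_gt_zero \<open>2 \<le> real k\<close>
    by (intro cos_ge_zero) (auto intro: order_trans[of _ 0])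
  then show ?thesis using enat assms by (simp add: cos_entry_def)
qed (use assms in \<open>simp add: cos_entry_def\<close>)

definition bil :: "('a \<Rightarrow> real) \<Rightarrow> ('a \<Rightarrow> real) \<Rightarrow> real" where
  "bil v w = (\<Sum>s\<in>S. \<Sum>t\<in>S. v s * w t * cos_entry s t)"

lemma bil_sym: "bil v w = bil w v"
proof -
  have "bil v w = (\<Sum>t\<in>S. \<Sum>s\<in>S. v s * w t * cos_entry s t)"
    unfolding bil_def by (rule sum.swap)
  also have "\<dots> = bil w v"
    unfolding bil_def by (auto intro!: sum.cong simp: cos_entry_sym)
  finally show ?thesis .
qed

lemma bil_lc_left [simp]: "bil (lc p u q v) w = p * bil u w + q * bil v w"
  by (simp add: bil_def sum_distrib_left sum.distrib[symmetric] algebra_simps)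

lemma bil_lc_right [simp]: "bil w (lc p u q v) = p * bil w u + q * bil w v"
  by (metis bil_lc_left bil_sym)

lemma bil_simple: "r \<in> S \<Longrightarrow> bil v (simple r) = (\<Sum>s\<in>S. v s * cos_entry s r)"
  unfolding bil_def simple_def
  by (auto intro!: sum.cong simp: finite_S if_distrib if_distribR cong: if_cong)

lemma bil_simple_simple [simp]: "s \<in> S \<Longrightarrow> t \<in> S \<Longrightarrow> bil (simple s) (simple t) = cos_entry s t"
  by (simp add: bil_simple) (simp add: simple_def finite_S if_distrib[of "\<lambda>x. x * _"] cong: if_cong)

lemma bil_eq_sum: "bil v w = (\<Sum>s\<in>S. v s * bil w (simple s))"
proof -
  have "bil v w = (\<Sum>s\<in>S. v s * (\<Sum>t\<in>S. w t * cos_entry s t))"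
    by (simp add: bil_def sum_distrib_left mult.assoc)
  also have "\<dots> = (\<Sum>s\<in>S. v s * bil w (simple s))"
    by (auto intro!: sum.cong arg_cong[where f = "(*) _"] simp: bil_simple cos_entry_sym)
  finally show ?thesis .
qed

definition reflection :: "('a \<Rightarrow> real) \<Rightarrow> ('a \<Rightarrow> real) \<Rightarrow> 'a \<Rightarrow> real" where
  "reflection a v = lc 1 v (- 2 * bil v a) a"

abbreviation srefl :: "'a \<Rightarrow> ('a \<Rightarrow> real) \<Rightarrow> 'a \<Rightarrow> real" where
  "srefl s \<equiv> reflection (simple s)"

lemma reflection_lc: "reflection a (lc p u q v) = lc p (reflection a u) q (reflection a v)"
  by (rule ext) (simp add: reflection_def algebra_simps)

lemma bil_reflection:
  assumes "bil a a = 1"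
  shows "bil (reflection a v) (reflection a w) = bil v w"
  using assms bil_sym[of a w] by (simp add: reflection_def algebra_simps)

lemma reflection_involution: "bil a a = 1 \<Longrightarrow> reflection a (reflection a v) = v"
  by (rule ext) (simp add: reflection_def algebra_simps)

lemma reflection_self: "bil a a = 1 \<Longrightarrow> reflection a a = (\<lambda>x. - a x)"
  by (rule ext) (simp add: reflection_def)

lemma reflection_uminus: "reflection a (\<lambda>x. - v x) = (\<lambda>x. - reflection a v x)"
  using reflection_lc[of a "-1" v 0 v] by (simp add: lc_def)

lemma refl_outside: "x \<noteq> s \<Longrightarrow> srefl s v x = v x"
  by (simp add: reflection_def simple_def)

abbreviation word_act :: "'a list \<Rightarrow> ('a \<Rightarrow> real) \<Rightarrow> 'a \<Rightarrow> real" where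
  "word_act \<equiv> foldr srefl"

lemma word_act_lc: "word_act w (lc p u q v) = lc p (word_act w u) q (word_act w v)"
  by (induction w) (simp_all only: foldr.simps comp_apply id_apply reflection_lc)

text \<open>Each reflection replaces one coordinate by 2c times the other one minus itself, which is
  the recursion of \<open>cheb\<close>.\<close>

lemma word_act_alt:
  assumes "s \<in> S" "t \<in> S" "s \<noteq> t"
  defines "c \<equiv> - cos_entry s t"
  shows "word_act (alt_word s t k) (simple s) =
    (if even k then lc (cheb c (Suc k)) (simple s) (cheb c k) (simple t)
     else lc (cheb c k) (simple s) (cheb c (Suc k)) (simple t))"
proof (induction k)
  case 0
  then show ?case by (auto simp: lc_def)
next
  case (Suc k)
  have step: "word_act (alt_word s t (Suc k)) (simple s)
      = srefl (if even k then t else s) (word_act (alt_word s t k) (simple s))" by simp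
  show ?case unfolding step Suc using assms(1,2) cos_entry_sym[of s t]
    by (auto simp: reflection_def c_def fun_eq_iff algebra_simps)
qed

lemma cheb_finite:
  assumes "s \<in> S" "t \<in> S" "s \<noteq> t" "m s t = enat n"
  shows "sin (pi / n) * cheb (- cos_entry s t) k = sin (k * pi / n)"
    and "sin (pi / n) > 0" and "cos_entry s t * cos_entry s t < 1"
proof -
  have n: "2 \<le> real n" using m_ge_2[OF assms] by simp
  have c: "- cos_entry s t = cos (pi / n)" using assms by (simp add: cos_entry_def)
  show "sin (pi / n) * cheb (- cos_entry s t) k = sin (k * pi / n)"
    unfolding c by (simp add: cheb_cos)
  show "sin (pi / n) > 0" using n by (intro sin_gt_zero) (auto simp: field_simps)
  then have "(sin (pi / n))\<^sup>2 > 0" by simp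
  then have "(cos (pi / n))\<^sup>2 < 1" using sin_cos_squared_add[of "pi / n"] by linarith
  then show "cos_entry s t * cos_entry s t < 1" by (metis c minus_mult_minus power2_eq_square)
qed

text \<open>The reason is sin (k pi / m) \<ge> 0 for k \<le> m; for m = \<infinity> the value is k
  itself.\<close>

lemma cheb_nonneg:
  assumes "s \<in> S" "t \<in> S" "s \<noteq> t" "enat k \<le> m s t"
  shows "0 \<le> cheb (- cos_entry s t) k"
proof (cases "m s t")
  case (enat n)
  then have "k \<le> n" using assms by simp
  moreover have "n > 0" using m_ge_2[OF assms(1-3) enat] by simp
  ultimately have "0 \<le> sin (k * pi / n)" by (intro sin_ge_zero) (auto simp: field_simps)
  then show ?thesis using cheb_finite[OF assms(1-3) enat] by (metis zero_le_mult_iff not_le)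
next
  case infinity
  then show ?thesis using assms(3) by (simp add: cos_entry_def cheb_one)
qed

lemma word_act_orthogonal:
  assumes "\<And>x. x \<in> set w \<Longrightarrow> bil v (simple x) = 0"
  shows "word_act w v = v"
  using assms by (induction w) (auto simp: reflection_def lc_def)

text \<open>On the nondegenerate plane spanned by the two simple roots \<open>(st)\<^sup>n\<close> is a rotation by
  \<open>2\<pi>\<close>; on its orthogonal complement it is the identity.\<close>

lemma word_act_braid:
  assumes "s \<in> S" "t \<in> S" "s \<noteq> t" "m s t = enat n"
  shows "word_act (alt_word s t (2 * n)) v = v"
proof -
  let ?c = "cos_entry s t"
  have "2 \<le> n" using m_ge_2[OF assms] .
  \<comment> \<open>The last letter only negates \<open>simple t\<close>. What is left is an
    alternating word of odd length \<open>l\<close> ending in \<open>s\<close>, to which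
    \<open>word_act_alt\<close> applies with the letters exchanged.\<close>
  define l where "l = 2 * n - 1"
  have l: "2 * n = Suc l" "odd l" using \<open>2 \<le> n\<close> by (auto simp: l_def)
  note ch = cheb_finite[OF assms]
  have U0: "cheb (- ?c) (Suc l) = 0"
  proof -
    have "sin (pi / n) * cheb (- ?c) (2 * n) = sin (real (2 * n) * pi / n)" by (rule ch)
    also have "real (2 * n) * pi / n = 2 * pi" using \<open>2 \<le> n\<close> by simp
    finally show ?thesis using ch(2) l by simp
  qed
  have U1: "cheb (- ?c) (Suc (Suc l)) = 1"
  proof -
    have "sin (pi / n) * cheb (- ?c) (Suc (2 * n)) = sin (real (Suc (2 * n)) * pi / n)" by (rule ch)
    also have "real (Suc (2 * n)) * pi / n = pi / n + 2 * pi" using \<open>2 \<le> n\<close> by (simp add: field_simps)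
    finally show ?thesis using ch(2) l by (simp only: sin_periodic) simp
  qed
  have U2: "cheb (- ?c) l = - 1" using U0 U1 by simp
  have a: "word_act (alt_word s t (2 * n)) (simple s) = simple s"
    unfolding word_act_alt[OF assms(1-3)] using U0 U1 l by (simp add: lc_def)
  have "word_act (alt_word s t (2 * n)) (simple t) = word_act (alt_word t s l) (srefl t (simple t))"
    unfolding l(1) alt_word_snoc by simp
  also have "srefl t (simple t) = lc (- 1) (simple t) 0 (simple t)"
    using assms by (simp add: reflection_self lc_def)
  also have "word_act (alt_word t s l) \<dots> = simple t"
    using U0 U2 l cos_entry_sym[of s t] assms
    by (simp add: word_act_lc word_act_alt fun_eq_iff del: cheb.simps)
  finally have b: "word_act (alt_word s t (2 * n)) (simple t) = simple t" .
  \<comment> \<open>By Cramer's rule with Gram determinant \<open>d\<close>, the numbers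
    \<open>p\<close> and \<open>q\<close> make \<open>v0\<close> orthogonal to both simple
    roots.\<close>
  define d where "d = 1 - ?c * ?c"
  define p where "p = (bil v (simple s) - ?c * bil v (simple t)) / d"
  define q where "q = (bil v (simple t) - ?c * bil v (simple s)) / d"
  define v0 where "v0 = lc 1 v (- 1) (lc p (simple s) q (simple t))"
  have "d \<noteq> 0" using ch(3) by (simp add: d_def)
  have "bil v0 (simple s) = 0" "bil v0 (simple t) = 0"
    using assms cos_entry_sym[of s t] \<open>d \<noteq> 0\<close>
    by (simp_all add: v0_def p_def q_def field_simps) (simp_all add: d_def algebra_simps)
  then have c: "word_act (alt_word s t (2 * n)) v0 = v0"
    using set_alt_word[of s t "2 * n"] by (intro word_act_orthogonal) auto
  have v: "v = lc 1 v0 1 (lc p (simple s) q (simple t))"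
    by (rule ext) (simp add: v0_def)
  show ?thesis
    by (subst (1 2) v) (simp add: word_act_lc a b c)
qed

text \<open>The defining relations act trivially, so the action of words becomes an action of the
  group.\<close>

lemma pres_eq_word_act:
  "pres_eq S (coxeter_relators S m) u v \<Longrightarrow> word_act (map fst u) = word_act (map fst v)"
proof (induction rule: pres_eq.induct)
  case (cancel u v s b)
  then show ?case by (auto simp: fun_eq_iff reflection_involution)
next
  case (relator u v r)
  have "word_act (map fst r) = (\<lambda>v. v)"
    using relator(3) unfolding coxeter_relators_def
  proof (elim UnE CollectE exE conjE)
    fix s assume "r = [(s, True), (s, True)]" "s \<in> S"
    then show ?thesis by (auto simp: fun_eq_iff reflection_involution)
  next
    fix s t k assume r: "r = concat (replicate k [(s, True), (t, True)])"
      and st: "s \<in> S" "t \<in> S" "s \<noteq> t" "m s t = enat k"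
    have "map fst r = alt_word s t (2 * k)" by (simp add: r alt_word_double map_concat)
    then show ?thesis using word_act_braid[OF st] by (simp add: fun_eq_iff)
  qed
  then show ?case by (intro ext) simp
qed auto

lemma word_act_cong:
  assumes "set u \<subseteq> S" "set v \<subseteq> S" "val u = val v"
  shows "word_act u = word_act v"
  using pres_eq_word_act[OF val_eq_imp_pres_eq[OF assms]] by (simp add: comp_def)

definition act :: "'a \<Rightarrow> ('a \<Rightarrow> real) \<Rightarrow> 'a \<Rightarrow> real" where
  "act g = word_act (SOME w. set w \<subseteq> S \<and> val w = g)"

lemma act_val: 
  assumes "set w \<subseteq> S" shows "act (val w) = word_act w"
proof -
  have "set (SOME u. set u \<subseteq> S \<and> val u = val w) \<subseteq> S \<and> val (SOME u. set u \<subseteq> S \<and> val u = val w) = val w"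
    by (rule someI_ex) (use assms in auto)
  then show ?thesis unfolding act_def using assms by (intro word_act_cong) auto
qed

lemma act_one [simp]: "act \<one> v = v"
  using act_val[of "[]"] by simp

lemma act_S: "s \<in> S \<Longrightarrow> act s = srefl s"
  using act_val[of "[s]"] by (simp add: fun_eq_iff)

lemma act_mult: "g \<in> carrier G \<Longrightarrow> h \<in> carrier G \<Longrightarrow> act (g \<otimes> h) v = act g (act h v)"
proof -
  assume "g \<in> carrier G" "h \<in> carrier G"
  then obtain u w where "set u \<subseteq> S" "val u = g" "set w \<subseteq> S" "val w = h" by (metis ex_word)
  then show ?thesis using act_val[of u] act_val[of w] act_val[of "u @ w"] by simp
qed

lemma act_lc: "act g (lc p u q v) = lc p (act g u) q (act g v)"
  by (simp add: act_def word_act_lc)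

lemma act_uminus: "act g (\<lambda>x. - v x) = (\<lambda>x. - act g v x)"
  using act_lc[of g "-1" v 0 v] by (simp add: lc_def)

lemma act_inv_cancel [simp]:
  "g \<in> carrier G \<Longrightarrow> act (inv g) (act g v) = v"
  "g \<in> carrier G \<Longrightarrow> act g (act (inv g) v) = v"
  by (simp_all flip: act_mult)

lemma bil_act: "g \<in> carrier G \<Longrightarrow> bil (act g v) (act g w) = bil v w"
proof -
  assume "g \<in> carrier G"
  then obtain u where u: "set u \<subseteq> S" "val u = g" by (metis ex_word)
  have "bil (word_act u v) (word_act u w) = bil v w"
    using u(1) by (induction u) (auto simp: bil_reflection)
  then show ?thesis using u act_val[of u] by simp
qed

text \<open>Preceded by a word of length \<open>n - 1\<close>, the alternating word of length
  \<open>n + 1\<close> spells the braid relator; so the two parts are mutually inverse and have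
  equal length in the group.\<close>

lemma len_alt_word_le:
  assumes "s \<in> S" "t \<in> S" "s \<noteq> t" "m s t = enat n"
  shows "len (val (alt_word s t (Suc n))) < n"
proof -
  have n: "2 \<le> n" using m_ge_2[OF assms] .
  obtain z where z: "length z = n - 1" "set z \<subseteq> {s, t}"
    "alt_word s t ((n - 1) + Suc n) = z @ alt_word s t (Suc n)"
    using alt_word_add[of "n - 1" s t "Suc n"] by blast
  have "(n - 1) + Suc n = 2 * n" using n by simp
  then have "val (alt_word s t ((n - 1) + Suc n)) = \<one>"
    using braid_val[OF assms] by (simp only: alt_word_double)
  moreover have S: "set z \<subseteq> S" "set (alt_word s t (Suc n)) \<subseteq> S"
    using z(2) set_alt_word[of s t "Suc n"] assms by blast+
  ultimately have "val z \<otimes> val (alt_word s t (Suc n)) = \<one>" using z(3) val_append by metis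
  then have "val z = inv (val (alt_word s t (Suc n)))"
    using S by (metis inv_equality val_closed)
  then have "len (val (alt_word s t (Suc n))) = len (val z)"
    using len_inv S val_closed by metis
  also have "\<dots> \<le> n - 1" using len_le[OF S(1)] z(1) by simp
  finally show ?thesis using n by simp
qed

lemma len_val_alt_word_drop:
  assumes "s \<in> S" "t \<in> S" "s \<noteq> t" "m s t = enat n" "n \<le> k"
  shows "len (val (alt_word s t (Suc k))) < k"
proof -
  obtain z where z: "length z = k - n" "set z \<subseteq> {s, t}"
    "alt_word s t ((k - n) + Suc n) = z @ alt_word s t (Suc n)"
    using alt_word_add[of "k - n" s t "Suc n"] by blast
  have S: "set z \<subseteq> S" "set (alt_word s t (Suc n)) \<subseteq> S"
    using z(2) set_alt_word[of s t "Suc n"] assms by blast+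
  have "(k - n) + Suc n = Suc k" using assms(5) by simp
  then have "val (alt_word s t (Suc k)) = val z \<otimes> val (alt_word s t (Suc n))"
    using z(3) S val_append by metis
  then have "len (val (alt_word s t (Suc k))) \<le> len (val z) + len (val (alt_word s t (Suc n)))"
    using len_mult S val_closed by metis
  then show ?thesis using len_le[OF S(1)] z(1) len_alt_word_le[OF assms(1-4)] assms(5) by linarith
qed

text \<open>Strip letters \<open>t, s, t, \<dots>\<close> off the end of \<open>g\<close> as long as the length drops. What remains has
  neither \<open>s\<close> nor \<open>t\<close> as a descent, so the induction hypothesis covers both.\<close>

theorem act_simple_pos:
  assumes "g \<in> carrier G" "s \<in> S" "len g < len (g \<otimes> s)"
  shows "pos (act g (simple s))"
  using assms
proof (induction "len g" arbitrary: g s rule: less_induct)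
  case less
  note g = \<open>g \<in> carrier G\<close> and s = \<open>s \<in> S\<close>
  show ?case
  proof (cases "g = \<one>")
    case True
    then show ?thesis by (simp add: pos_def simple_def)
  next
    case False
    then obtain t where t: "t \<in> S" "len (g \<otimes> t) < len g" using ex_descent g by blast
    then have st: "s \<noteq> t" using less.prems(3) by auto
    \<comment> \<open>\<open>P k\<close> says that \<open>g\<close> ends, without loss of length, in
      the alternating word of length \<open>k\<close>. The largest such \<open>k\<close> is
      used.\<close>
    define P where "P k \<longleftrightarrow> (\<exists>v \<in> carrier G. g = v \<otimes> val (alt_word s t k) \<and> len v + k = len g)" for k
    have setS: "set (alt_word x y k) \<subseteq> S" if "x \<in> {s,t}" "y \<in> {s,t}" for x y k
      using set_alt_word[of x y k] that s t(1) by blast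
    have P1: "P 1"
      unfolding P_def by (rule bexI[of _ "g \<otimes> t"]) (use g t len_mult_S_cases[OF g t(1)] in auto)
    have "\<forall>k. P k \<longrightarrow> k \<le> len g" by (auto simp: P_def)
    then obtain k where k: "P k" "\<And>j. P j \<Longrightarrow> j \<le> k"
      using P1 by (metis GreatestI_nat Greatest_le_nat)
    have "k \<ge> 1" using k(2)[OF P1] .
    then obtain l where l: "k = Suc l" by (cases k) auto
    obtain v where v: "v \<in> carrier G" "g = v \<otimes> val (alt_word s t k)" "len v + k = len g"
      using k(1) by (auto simp: P_def)
    \<comment> \<open>\<open>x\<close> is the letter stripped last and \<open>y\<close> the one that
      would come next. A descent \<open>x\<close> of \<open>v\<close> would make \<open>g\<close>
      too short, a descent \<open>y\<close> would contradict the maximality of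
      \<open>k\<close>.\<close>
    define x where "x = (if even l then t else s)"
    define y where "y = (if even k then t else s)"
    have xy: "{x, y} = {s, t}" "x \<in> S" "y \<in> S" using s t by (auto simp: x_def y_def l)
    have vx: "len v < len (v \<otimes> x)"
    proof (rule ccontr)
      assume "\<not> ?thesis"
      then have "len (v \<otimes> x) + 1 = len v" using len_mult_S_cases[OF v(1) xy(2)] by linarith
      moreover have "g = (v \<otimes> x) \<otimes> val (alt_word s t l)"
        using v xy(2) setS[of s t l] by (simp add: l x_def m_assoc)
      then have "len g \<le> len (v \<otimes> x) + l"
        using len_mult[of "v \<otimes> x" "val (alt_word s t l)"] len_le[OF setS[of s t l]] v(1) xy(2) setS[of s t l] by fastforce
      ultimately show False using v(3) l by linarith
    qed
    have vy: "len v < len (v \<otimes> y)"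
    proof (rule ccontr)
      assume "\<not> ?thesis"
      then have "len (v \<otimes> y) + 1 = len v" using len_mult_S_cases[OF v(1) xy(3)] by linarith
      moreover have "g = (v \<otimes> y) \<otimes> val (alt_word s t (Suc k))"
        using v xy(3) setS[of s t k] by (simp add: y_def[symmetric] m_assoc[symmetric])
      ultimately have "P (Suc k)" unfolding P_def using v xy(3) by (intro bexI[of _ "v \<otimes> y"]) auto
      then show False using k(2) by fastforce
    qed
    have "len v < len g" using v(3) l by simp
    moreover have "len v < len (v \<otimes> s)" "len v < len (v \<otimes> t)" using vx vy xy(1) by (auto simp: doubleton_eq_iff)
    ultimately have pos: "pos (act v (simple s))" "pos (act v (simple t))"
      using less.hyps v(1) s t(1) by blast+
    \<comment> \<open>Needed for non-negative coefficients. Otherwise the braid relation shortens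
      the alternating end of \<open>g \<otimes> s\<close>, although \<open>s\<close> is not a
      descent of \<open>g\<close>.\<close>
    have "enat (Suc k) \<le> m s t"
    proof (rule ccontr)
      assume *: "\<not> ?thesis"
      then obtain n where n: "m s t = enat n" by (cases "m s t") auto
      then have "n \<le> k" using * by simp
      have "g \<otimes> s = v \<otimes> val (alt_word t s (Suc k))"
        unfolding alt_word_snoc using v s setS[of s t k] by (simp add: m_assoc)
      then have "len (g \<otimes> s) \<le> len v + len (val (alt_word t s (Suc k)))"
        using len_mult v(1) setS[of t s "Suc k"] by (metis insertI1 insert_commute val_closed)
      moreover have "len (val (alt_word t s (Suc k))) < k"
        by (rule len_val_alt_word_drop[of _ _ n]) (use n \<open>n \<le> k\<close> s t(1) st m_sym[of s t] in auto)
      ultimately show False using v(3) less.prems(3) by linarith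
    qed
    moreover from this have "enat k \<le> m s t" by (meson enat_ord_simps(1) le_Suc_eq order_trans order_refl)
    ultimately have U: "0 \<le> cheb (- cos_entry s t) (Suc k)" "0 \<le> cheb (- cos_entry s t) k"
      using cheb_nonneg s t(1) st by blast+
    have "act g (simple s) = act v (word_act (alt_word s t k) (simple s))"
      using v(1) setS[of s t k] by (simp add: v(2) act_mult act_val)
    then show ?thesis
      using U pos by (auto simp: word_act_alt[OF s t(1) st] act_lc pos_def)
  qed
qed

section \<open>Roots and dominance\<close>

lemma reflection_apply: "reflection a v x = v x - 2 * bil v a * a x"
  by (simp add: reflection_def)

lemma pos_lc_diff: "0 \<le> p \<Longrightarrow> 0 \<le> q \<Longrightarrow> pos u \<Longrightarrow> neg v \<Longrightarrow> pos (lc p u (- q) v)"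
  unfolding pos_def neg_def by (simp add: mult_nonneg_nonpos order_trans[of _ 0])

lemma neg_lc_diff: "0 \<le> p \<Longrightarrow> 0 \<le> q \<Longrightarrow> neg u \<Longrightarrow> pos v \<Longrightarrow> neg (lc p u (- q) v)"
  unfolding pos_def neg_def by (simp add: mult_nonneg_nonpos order_trans[of _ 0])

lemma act_simple_neg:
  assumes "g \<in> carrier G" "s \<in> S" "len (g \<otimes> s) < len g"
  shows "neg (act g (simple s))"
proof -
  have "pos (act (g \<otimes> s) (simple s))"
    using act_simple_pos[of "g \<otimes> s" s] assms by simp
  then show ?thesis
    using assms by (simp add: act_mult act_S reflection_self act_uminus)
qed

definition roots :: "('a \<Rightarrow> real) set" where
  "roots = {act g (simple s) | g s. g \<in> carrier G \<and> s \<in> S}"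

lemma rootI: "g \<in> carrier G \<Longrightarrow> s \<in> S \<Longrightarrow> act g (simple s) \<in> roots"
  by (auto simp: roots_def)

lemma rootE:
  assumes "a \<in> roots"
  obtains g s where "g \<in> carrier G" "s \<in> S" "a = act g (simple s)"
  using assms by (auto simp: roots_def)

lemma root_norm: "a \<in> roots \<Longrightarrow> bil a a = 1"
  by (auto simp: roots_def bil_act)

lemma act_root: "g \<in> carrier G \<Longrightarrow> a \<in> roots \<Longrightarrow> act g a \<in> roots"
  by (elim rootE) (simp add: rootI flip: act_mult)

lemma simple_root: "s \<in> S \<Longrightarrow> simple s \<in> roots"
  using rootI[of \<one> s] by simp

lemma pos_simple [simp]: "pos (simple s)" and not_neg_simple [simp]: "\<not> neg (simple s)"
  by (auto simp: pos_def neg_def simple_def intro!: exI[of _ s])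

lemma uminus_root:
  assumes "a \<in> roots" shows "(\<lambda>x. - a x) \<in> roots"
proof -
  obtain g s where g: "g \<in> carrier G" "s \<in> S" "a = act g (simple s)"
    using assms by (rule rootE)
  then have "(\<lambda>x. - a x) = act (g \<otimes> s) (simple s)"
    by (simp add: act_mult act_S reflection_self act_uminus)
  then show ?thesis using g by (simp add: rootI)
qed

lemma root_sign: "a \<in> roots \<Longrightarrow> neg a \<longleftrightarrow> \<not> pos a"
proof -
  assume a: "a \<in> roots"
  then obtain g s where g: "g \<in> carrier G" "s \<in> S" "a = act g (simple s)"
    by (rule rootE)
  then have "pos a \<or> neg a"
    using act_simple_pos[of g s] act_simple_neg[of g s] len_mult_S_neq[of g s] by (meson linorder_neqE_nat)
  moreover have False if "pos a" "neg a"
  proof -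
    have "a = (\<lambda>x. 0)" using that by (auto simp: pos_def neg_def fun_eq_iff antisym)
    then show False using root_norm[OF a] by (simp add: bil_def)
  qed
  ultimately show ?thesis by blast
qed

lemma act_outside: "g \<in> carrier G \<Longrightarrow> x \<notin> T \<Longrightarrow> T \<subseteq> S \<Longrightarrow> g \<in> generate G T \<Longrightarrow> act g v x = v x"
proof -
  assume x: "x \<notin> T" and T: "T \<subseteq> S" and "g \<in> generate G T"
  then obtain w where w: "set w \<subseteq> T" "val w = g" using generate_words by blast
  have "set w \<subseteq> T \<Longrightarrow> word_act w v x = v x" for w using x
  proof (induction w)
    case (Cons y w)
    then have "x \<noteq> y" using x by auto
    then show ?case using Cons by (simp add: refl_outside)
  qed simp
  then show ?thesis using act_val[of w] w T by auto
qed

lemma root_outside: "a \<in> roots \<Longrightarrow> x \<notin> S \<Longrightarrow> a x = 0"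
  using act_outside[of _ x S] generate_S by (auto simp: roots_def simple_def)

text \<open>\<open>s\<close> changes only the coordinate at \<open>s\<close>, so a positive root
  that it makes negative has no other coordinate, and norm 1 leaves only
  \<open>simple s\<close>.\<close>

lemma simple_reflection_pos:
  assumes "a \<in> roots" "pos a" "s \<in> S" "a \<noteq> simple s"
  shows "pos (srefl s a)"
proof (rule ccontr)
  assume "\<not> ?thesis"
  moreover have "srefl s a \<in> roots" using act_root[of s a] assms by (simp add: act_S)
  ultimately have "neg (srefl s a)" using root_sign by blast
  then have "a x = 0" if "x \<noteq> s" for x
    using assms(2) refl_outside[OF that, of a] unfolding pos_def neg_def
    by (metis order_antisym)
  then have a: "a = lc (a s) (simple s) 0 a" by (auto simp: fun_eq_iff simple_def)
  have "bil (lc (a s) (simple s) 0 a) (lc (a s) (simple s) 0 a) = 1"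
    using root_norm[OF assms(1)] a by simp
  then have "a s = 1 \<or> a s = - 1" using assms(3) by (simp add: square_eq_1_iff)
  moreover have "a s \<ge> 0" using assms(2) by (simp add: pos_def)
  ultimately have "a s = 1" by linarith
  then show False using a assms(4) by (auto simp: lc_def)
qed

text \<open>For \<open>a = act g (simple s)\<close> it is the conjugate of \<open>s\<close> by
  \<open>g\<close>.\<close>

lemma ex_reflection:
  assumes "a \<in> roots"
  obtains t where "t \<in> carrier G" "\<And>v. act t v = reflection a v"
proof -
  obtain g s where g: "g \<in> carrier G" "s \<in> S" "a = act g (simple s)"
    using assms by (auto simp: roots_def)
  show ?thesis
  proof
    show "g \<otimes> s \<otimes> inv g \<in> carrier G" using g by simp
    fix v
    have "act (g \<otimes> s \<otimes> inv g) v = act g (srefl s (act (inv g) v))"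
      using g by (simp add: act_mult act_S)
    also have "\<dots> = lc 1 v (- 2 * bil (act (inv g) v) (simple s)) a"
      using g by (simp add: reflection_def act_lc)
    also have "bil (act (inv g) v) (simple s) = bil v a"
      using g bil_act[of g "act (inv g) v" "simple s"] by simp
    finally show "act (g \<otimes> s \<otimes> inv g) v = reflection a v" unfolding reflection_def .
  qed
qed

definition pos_roots :: "('a \<Rightarrow> real) set" where "pos_roots = {a \<in> roots. pos a}"

definition inversions :: "'a \<Rightarrow> ('a \<Rightarrow> real) set" where
  "inversions g = {a \<in> pos_roots. neg (act g a)}"

text \<open>By \<open>simple_reflection_pos\<close>, a positive root can become negative only at a
  letter whose simple root is the current vector.\<close>

lemma word_act_sign_change:
  assumes "set w \<subseteq> S" "a \<in> pos_roots" "neg (word_act w a)"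
  shows "\<exists>u x z. w = u @ x # z \<and> word_act z a = simple x"
  using assms
proof (induction w)
  case Nil
  then show ?case using root_sign by (auto simp: pos_roots_def)
next
  case (Cons y w)
  show ?case
  proof (cases "neg (word_act w a)")
    case True
    then obtain u x z where "w = u @ x # z \<and> word_act z a = simple x" using Cons by auto
    then show ?thesis by (intro exI[of _ "y # u"]) auto
  next
    case False
    have "word_act w a \<in> roots"
      using act_root[of "val w" a] Cons.prems by (simp add: act_val pos_roots_def)
    moreover from this have "pos (word_act w a)" using False root_sign by blast
    moreover have "neg (srefl y (word_act w a))" using Cons.prems by simp
    ultimately have "word_act w a = simple y"
      using simple_reflection_pos[of "word_act w a" y] Cons.prems root_sign[of "srefl y (word_act w a)"]
        act_root[of y "word_act w a"] act_S[of y] by auto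
    then show ?thesis by (intro exI[of _ "[]"]) auto
  qed
qed

text \<open>For a fixed word of \<open>g\<close>, an inversion is determined by the position and
  letter at which its sign changes.\<close>

lemma finite_inversions:
  assumes "g \<in> carrier G" shows "finite (inversions g)"
proof -
  obtain w where w: "set w \<subseteq> S" "val w = g" using ex_word assms by blast
  have "inversions g \<subseteq> (\<lambda>(i, x). act (inv (val (drop i w))) (simple x)) ` ({..length w} \<times> S)"
  proof
    fix a assume "a \<in> inversions g"
    then have "a \<in> pos_roots" "neg (word_act w a)" using w act_val[of w] by (auto simp: inversions_def)
    then obtain u x z where z: "w = u @ x # z" "word_act z a = simple x"
      using word_act_sign_change w(1) by blast
    have zS: "set z \<subseteq> S" "x \<in> S" using w(1) z(1) by auto
    then have "a = act (inv (val z)) (act (val z) a)" by simp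
    also have "act (val z) a = simple x" using zS z(2) by (simp add: act_val)
    also have "z = drop (Suc (length u)) w" using z(1) by simp
    finally have "a = act (inv (val (drop (Suc (length u)) w))) (simple x)" .
    moreover have "Suc (length u) \<le> length w" using z(1) by simp
    ultimately show "a \<in> (\<lambda>(i, x). act (inv (val (drop i w))) (simple x)) ` ({..length w} \<times> S)"
      using zS(2) by (intro image_eqI[of _ _ "(Suc (length u), x)"]) auto
  qed
  then show ?thesis by (rule finite_subset) (use finite_S in auto)
qed

section \<open>The dominance order and its minimal elements\<close>

definition dominates :: "('a \<Rightarrow> real) \<Rightarrow> ('a \<Rightarrow> real) \<Rightarrow> bool" where
  "dominates a b \<longleftrightarrow> (\<forall>g \<in> carrier G. neg (act g a) \<longrightarrow> neg (act g b))"

lemma dominates_trans: "dominates a b \<Longrightarrow> dominates b c \<Longrightarrow> dominates a c"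
  by (simp add: dominates_def)

text \<open>\<open>s\<close> makes \<open>simple s\<close> negative and no other positive
  root.\<close>

lemma dominates_simple:
  assumes "dominates (simple s) b" "s \<in> S" "b \<in> pos_roots"
  shows "b = simple s"
proof (rule ccontr)
  assume "b \<noteq> simple s"
  then have "pos (srefl s b)" using assms simple_reflection_pos by (auto simp: pos_roots_def)
  moreover have "neg (srefl s (simple s))" using assms(2) by (simp add: reflection_self)
  then have "neg (srefl s b)" using assms(1,2) act_S unfolding dominates_def by (metis S_closed)
  ultimately show False using root_sign[of "srefl s b"] act_root[of s b] assms by (simp add: act_S pos_roots_def)
qed

text \<open>Dominance is invariant under the group, so \<open>a\<close> can be moved to a simple
  root. The converse dominance keeps the image of \<open>b\<close> positive, as
  \<open>dominates_simple\<close> requires.\<close>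

lemma dominates_antisym:
  assumes "a \<in> roots" "b \<in> roots" "dominates a b" "dominates b a"
  shows "a = b"
proof -
  obtain g s where g: "g \<in> carrier G" "s \<in> S" "a = act g (simple s)"
    using assms(1) by (rule rootE)
  have "pos (act (inv g) b)"
  proof (rule ccontr)
    assume "\<not> ?thesis"
    then have "neg (act (inv g) b)" using root_sign act_root assms(2) g(1) by simp
    then have "neg (act (inv g) a)" using assms(4) g(1) by (auto simp: dominates_def)
    then show False using g by simp
  qed
  then have b': "act (inv g) b \<in> pos_roots" using act_root assms(2) g(1) by (simp add: pos_roots_def)
  have "dominates (simple s) (act (inv g) b)"
    unfolding dominates_def
  proof (intro ballI impI)
    fix h assume h: "h \<in> carrier G" "neg (act h (simple s))"
    then have "neg (act (h \<otimes> inv g) a)" using g by (simp add: act_mult)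
    then have "neg (act (h \<otimes> inv g) b)" using assms(3) h g(1) by (auto simp: dominates_def)
    then show "neg (act h (act (inv g) b))" using h g(1) by (simp add: act_mult)
  qed
  then have "act (inv g) b = simple s" using dominates_simple g(2) b' by blast
  then have "act g (act (inv g) b) = a" using g(3) by simp
  then show ?thesis using g(1) by simp
qed

definition small_roots :: "('a \<Rightarrow> real) set" where
  "small_roots = {a \<in> pos_roots. \<forall>b \<in> pos_roots. dominates a b \<longrightarrow> b = a}"

text \<open>The reflection in \<open>a\<close> makes \<open>a\<close> negative and hence inverts
  every positive root that \<open>a\<close> dominates.\<close>

lemma finite_dominated:
  assumes "a \<in> pos_roots" shows "finite {b \<in> pos_roots. dominates a b}"
proof -
  have a: "a \<in> roots" "pos a" using assms by (auto simp: pos_roots_def)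
  obtain t where t: "t \<in> carrier G" "\<And>v. act t v = reflection a v" using ex_reflection[OF a(1)] by blast
  have "neg (act t a)" using a by (simp add: t(2) reflection_self root_norm)
  then have "{b \<in> pos_roots. dominates a b} \<subseteq> inversions t"
    using t(1) by (auto simp: dominates_def inversions_def)
  then show ?thesis using finite_inversions[OF t(1)] by (rule finite_subset)
qed

text \<open>Among the positive roots that \<open>a\<close> dominates, one that itself dominates
  fewest is minimal, by antisymmetry.\<close>

lemma ex_small_dominated:
  assumes "a \<in> pos_roots"
  shows "\<exists>b \<in> small_roots. dominates a b"
proof -
  let ?D = "\<lambda>a. {b \<in> pos_roots. dominates a b}"
  have "a \<in> ?D a" using assms by (simp add: dominates_def)
  then obtain b where b: "b \<in> ?D a" "\<And>c. c \<in> ?D a \<Longrightarrow> card (?D b) \<le> card (?D c)"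
    using ex_has_least_nat[of "\<lambda>b. b \<in> ?D a" a "\<lambda>b. card (?D b)"] by blast
  have "b \<in> small_roots"
    unfolding small_roots_def
  proof (intro CollectI conjI ballI impI)
    show "b \<in> pos_roots" using b(1) by simp
    fix c assume c: "c \<in> pos_roots" "dominates b c"
    show "c = b"
    proof (rule ccontr)
      assume "c \<noteq> b"
      then have "\<not> dominates c b"
        using dominates_antisym[of b c] b(1) c by (auto simp: pos_roots_def)
      moreover have "dominates b b" by (simp add: dominates_def)
      ultimately have "?D c \<subset> ?D b" using c b(1) dominates_trans[of b c] by blast
      then have "card (?D c) < card (?D b)" using finite_dominated b(1) psubset_card_mono by blast
      moreover have "c \<in> ?D a" using b(1) c dominates_trans[of a b c] by blast
      ultimately show False using b(2)[of c] by simp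
    qed
  qed
  then show ?thesis using b(1) by blast
qed

lemma act_pow_Suc: "c \<in> carrier G \<Longrightarrow> act (c [^] Suc k) v = act c (act (c [^] k) v)"
  by (subst nat_pow_Suc2) (simp_all add: act_mult)

lemma act_pow_fixed:
  assumes "c \<in> carrier G" "act (c [^] (i::nat)) v = act (c [^] (i + d)) v"
  shows "act (c [^] d) v = v"
proof -
  have "act (c [^] (i + d)) v = act (c [^] i) (act (c [^] d) v)"
    using assms(1) by (simp add: act_mult nat_pow_mult flip: nat_pow_mult)
  then show ?thesis using assms by (metis act_inv_cancel(1) nat_pow_closed)
qed

lemma act_orbit_inj:
  assumes "c \<in> carrier G" "\<And>d. d > 0 \<Longrightarrow> act (c [^] (d::nat)) v \<noteq> v"
  shows "inj (\<lambda>k::nat. act (c [^] k) v)"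
proof (rule linorder_injI)
  fix i j :: nat assume "i < j"
  then obtain d where "j = i + d" "d > 0" by (metis less_imp_add_positive)
  then show "act (c [^] i) v \<noteq> act (c [^] j) v" using act_pow_fixed[OF assms(1)] assms(2) by blast
qed

text \<open>If \<open>a\<close> and \<open>b\<close> are incomparable, some \<open>g\<close> makes \<open>a\<close> negative and \<open>b\<close> positive and some \<open>g'\<close>
  does the opposite. The infinitely many roots \<open>p a - q b\<close> with \<open>p, q \<ge> 0\<close> then yield infinitely
  many inversions of \<open>g g'\<^sup>-\<^sup>1\<close>.\<close>

lemma dominates_cases:
  assumes ab: "a \<in> pos_roots" "b \<in> pos_roots" and "1 \<le> bil a b" "a \<noteq> b"
  shows "dominates a b \<or> dominates b a"
proof (rule ccontr)
  assume "\<not> ?thesis"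
  then obtain g h where g: "g \<in> carrier G" "neg (act g a)" "\<not> neg (act g b)"
    and h: "h \<in> carrier G" "neg (act h b)" "\<not> neg (act h a)"
    by (auto simp: dominates_def)
  have root: "a \<in> roots" "b \<in> roots" using ab by (auto simp: pos_roots_def)
  have gb: "pos (act g b)" "pos (act h a)" using g h root act_root root_sign by blast+
  obtain t where t: "t \<in> carrier G" "\<And>v. act t v = reflection a v" using ex_reflection[OF root(1)] by blast
  obtain u where u: "u \<in> carrier G" "\<And>v. act u v = reflection b v" using ex_reflection[OF root(2)] by blast
  define c where "c = t \<otimes> u"
  have c: "c \<in> carrier G" using t u by (simp add: c_def)
  define B where "B = bil a b"
  have B: "B \<ge> 1" "bil b a = B" using assms bil_sym by (auto simp: B_def)
  have step: "act c (lc p a (- q) b) = lc (2 * (2 * p * B - q) * B - p) a (- (2 * p * B - q)) b" for p q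
  proof -
    have 1: "act u (lc p a (- q) b) = lc p a (- (2 * p * B - q)) b"
      unfolding u(2) using root by (simp add: fun_eq_iff reflection_def root_norm B_def algebra_simps)
    have 2: "act t (lc p a (- r) b) = lc (2 * r * B - p) a (- r) b" for r
      unfolding t(2) using root B(2) by (simp add: fun_eq_iff reflection_def root_norm algebra_simps)
    show ?thesis unfolding c_def act_mult[OF t(1) u(1)] 1 2 ..
  qed
  \<comment> \<open>Since \<open>B \<ge> 1\<close>, the coefficients grow along the orbit; the
    strict bounds for k > 0 exclude a return to \<open>a\<close>.\<close>
  have orbit: "\<exists>p q. act (c [^] k) a = lc p a (- q) b \<and> 0 \<le> q \<and> q < p \<and> (k > 0 \<longrightarrow> 1 < p \<and> 0 < q)" for k :: nat
  proof (induction k)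
    case 0
    show ?case by (intro exI[of _ 1] exI[of _ 0]) (auto simp: lc_def)
  next
    case (Suc k)
    then obtain p q where pq: "act (c [^] k) a = lc p a (- q) b" "0 \<le> q" "q < p" "k > 0 \<longrightarrow> 1 < p \<and> 0 < q" by blast
    \<comment> \<open>The coefficients come from an existential statement, so even for k = 0 the
      bound has to be recovered, by pairing with \<open>a\<close>.\<close>
    have p1: "p \<ge> 1"
    proof (cases "k = 0")
      case True
      have "bil (lc p a (- q) b) a = 1" using pq(1) True root root_norm by simp
      then have "p - q * B = 1" using root root_norm B by simp
      moreover have "0 \<le> q * B" using pq(2) B by simp
      ultimately show ?thesis by linarith
    qed (use pq in auto)
    define q' where "q' = 2 * p * B - q"
    have "p \<le> p * B" using B pq by (simp add: mult_le_cancel_left1)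
    then have q': "q' > p" using pq unfolding q'_def by linarith
    then have "q' \<le> q' * B" using B pq by (simp add: mult_le_cancel_left1)
    then have p': "2 * q' * B - p > q'" using q' by linarith
    have "act (c [^] Suc k) a = lc (2 * q' * B - p) a (- q') b"
      unfolding act_pow_Suc[OF c] pq(1) step q'_def ..
    then show ?case using q' p' p1 pq by (intro exI[of _ "2 * q' * B - p"] exI[of _ q']) auto
  qed
  have "inj (\<lambda>k::nat. act (c [^] k) a)"
  proof (rule act_orbit_inj[OF c])
    fix d :: nat assume "d > 0"
    then obtain p q where pq: "act (c [^] d) a = lc p a (- q) b" "1 < p" "0 < q" using orbit by blast
    show "act (c [^] d) a \<noteq> a"
    proof
      assume "act (c [^] d) a = a"
      then have *: "lc (p - 1) a 0 a = lc q b 0 b" using pq(1) by (auto simp: fun_eq_iff algebra_simps)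
      then have "bil (lc (p - 1) a 0 a) (lc (p - 1) a 0 a) = bil (lc q b 0 b) (lc q b 0 b)" by simp
      then have "(p - 1)\<^sup>2 = q\<^sup>2" using root by (simp add: root_norm power2_eq_square)
      then have "p - 1 = q" using pq by (simp add: power2_eq_iff_nonneg)
      then have "a = b" using * pq by (auto simp: fun_eq_iff)
      then show False using assms by simp
    qed
  qed
  then have "infinite (range (\<lambda>k::nat. act (c [^] k) a))" by (simp add: finite_image_iff)
  moreover have "inj (act h)" by (rule inj_on_inverseI[of _ "act (inv h)"]) (use h in simp)
  ultimately have "infinite (act h ` range (\<lambda>k::nat. act (c [^] k) a))"
    by (simp add: finite_image_iff inj_on_subset)
  moreover have "act h ` range (\<lambda>k::nat. act (c [^] k) a) \<subseteq> inversions (g \<otimes> inv h)"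
  proof (intro image_subsetI, elim rangeE)
    fix v and k :: nat assume v: "v = act (c [^] k) a"
    obtain p q where pq: "v = lc p a (- q) b" "0 \<le> q" "q < p" using orbit[of k] v by auto
    have "v \<in> roots" unfolding v using root c by (simp add: act_root)
    moreover have "pos (act h v)"
      using pq h gb by (auto simp: act_lc intro!: pos_lc_diff)
    moreover have "neg (act g v)"
      using pq g gb by (auto simp: act_lc intro!: neg_lc_diff)
    ultimately show "act h v \<in> inversions (g \<otimes> inv h)"
      using g h by (simp add: inversions_def pos_roots_def act_root act_mult)
  qed
  ultimately show False using finite_inversions[of "g \<otimes> inv h"] g h finite_subset by blast
qed

lemma small_roots_bil_less_1:
  assumes "a \<in> small_roots" "b \<in> small_roots" "a \<noteq> b"
  shows "bil a b < 1"
  using dominates_cases[of a b] assms by (force simp: small_roots_def)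

lemma simple_small: "s \<in> S \<Longrightarrow> simple s \<in> small_roots"
  using dominates_simple by (auto simp: small_roots_def pos_roots_def simple_root)

text \<open>If \<open>srefl s a\<close> dominates \<open>b\<close>, then \<open>a\<close> dominates
  \<open>srefl s b\<close>, which is a positive root unless \<open>b = simple s\<close>. That
  exception is ruled out by the reflection in \<open>srefl s a\<close>: because the pairing is
  positive, the image of \<open>simple s\<close> keeps a positive coordinate at
  \<open>s\<close>.\<close>

lemma small_descent:
  assumes "a \<in> small_roots" "s \<in> S" "0 < bil a (simple s)" "a \<noteq> simple s"
  shows "srefl s a \<in> small_roots"
proof -
  have a: "a \<in> roots" "pos a" using assms(1) by (auto simp: small_roots_def pos_roots_def)
  have sa: "srefl s a \<in> pos_roots"
    using simple_reflection_pos[OF a assms(2,4)] act_root[of s a] a assms(2) by (simp add: pos_roots_def act_S)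
  have inv2: "srefl s (srefl s v) = v" for v using assms(2) by (simp add: reflection_involution)
  have "b = srefl s a" if b: "b \<in> pos_roots" "dominates (srefl s a) b" for b
  proof (cases "b = simple s")
    case True
    obtain t where t: "t \<in> carrier G" "\<And>v. act t v = reflection (srefl s a) v"
      using ex_reflection[of "srefl s a"] sa by (auto simp: pos_roots_def)
    have "neg (act t (srefl s a))"
      using sa t(2) by (simp add: pos_roots_def reflection_self root_norm)
    then have "neg (act t (simple s))" using b(2) True t(1) by (auto simp: dominates_def)
    then have "act t (simple s) s \<le> 0" by (simp add: neg_def)
    moreover have "bil (simple s) (srefl s a) = - bil a (simple s)"
      using assms(2) bil_sym[of "simple s" a] by (simp add: reflection_def)
    then have "act t (simple s) s = 1 + 2 * bil a (simple s) * srefl s a s"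
      unfolding t(2) reflection_apply[of "srefl s a" "simple s"] by (simp add: simple_def[of s])
    moreover have "srefl s a s \<ge> 0" using sa by (auto simp: pos_roots_def pos_def)
    ultimately show ?thesis using assms(3) by (smt (verit) mult_nonneg_nonneg)
  next
    case False
    have sb: "srefl s b \<in> pos_roots"
      using simple_reflection_pos[of b s] act_root[of s b] b False assms(2) by (auto simp: pos_roots_def act_S)
    have "dominates a (srefl s b)"
      unfolding dominates_def
    proof (intro ballI impI)
      fix g assume g: "g \<in> carrier G" "neg (act g a)"
      then have "neg (act (g \<otimes> s) (srefl s a))" using assms(2) by (simp add: act_mult act_S inv2)
      then have "neg (act (g \<otimes> s) b)" using b(2) g assms(2) by (auto simp: dominates_def)
      then show "neg (act g (srefl s b))" using g assms(2) by (simp add: act_mult act_S)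
    qed
    then have "srefl s b = a" using assms(1) sb by (auto simp: small_roots_def)
    then show ?thesis using inv2[of b] by simp
  qed
  then show ?thesis using sa by (auto simp: small_roots_def)
qed

section \<open>Pairs of roots spanning a positive definite plane\<close>

lemma pos_root_coordinate: "a \<in> roots \<Longrightarrow> pos a \<Longrightarrow> \<exists>s. 0 < a s"
  using root_sign[of a] by (auto simp: neg_def not_le)

lemma root_pos_if_coordinate: "a \<in> roots \<Longrightarrow> 0 < a s \<Longrightarrow> pos a"
  using root_sign[of a] unfolding neg_def by (meson not_le)

lemma root_neg_if_coordinate: "a \<in> roots \<Longrightarrow> a s < 0 \<Longrightarrow> neg a"
  using root_sign[of a] unfolding pos_def by (meson not_le)

text \<open>Otherwise the rotation has a dense orbit of roots on the unit circle of the plane, and the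
  infinitely many of them that are close to \<open>a\<close> are all inverted by the reflection in \<open>a\<close>.\<close>

lemma rotation_has_fixed_root:
  assumes a: "a \<in> pos_roots" and b: "b \<in> roots" and ab: "\<bar>bil a b\<bar> < 1"
    and t: "t \<in> carrier G" "\<And>v. act t v = reflection a v"
    and u: "u \<in> carrier G" "\<And>v. act u v = reflection b v"
  shows "\<exists>n>0. act ((t \<otimes> u) [^] (n::nat)) a = a"
proof (rule ccontr)
  assume neg: "\<not> ?thesis"
  define c where "c = t \<otimes> u"
  have c: "c \<in> carrier G" using t u by (simp add: c_def)
  have root: "a \<in> roots" "pos a" using a by (auto simp: pos_roots_def)
  define B where "B = bil a b"
  have B: "\<bar>B\<bar> < 1" "bil b a = B" using ab bil_sym by (auto simp: B_def)
  have inj: "inj (\<lambda>k::nat. act (c [^] k) a)"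
  proof (rule act_orbit_inj[OF c])
    fix d :: nat assume "d > 0"
    then show "act (c [^] d) a \<noteq> a" using neg unfolding c_def by blast
  qed
  have "\<exists>p q. act (c [^] k) a = lc p a q b" for k :: nat
  proof (induction k)
    case 0
    show ?case by (intro exI[of _ 1] exI[of _ 0]) (auto simp: lc_def)
  next
    case (Suc k)
    then obtain p q where pq: "act (c [^] k) a = lc p a q b" by blast
    have "act c (lc p a q b) = lc (p - 2 * bil (lc 1 (lc p a q b) (- 2 * bil (lc p a q b) b) b) a) a
        (q - 2 * bil (lc p a q b) b) b"
      using t u by (simp add: c_def act_mult) (simp add: reflection_def fun_eq_iff algebra_simps)
    then show ?case unfolding act_pow_Suc[OF c] pq by blast
  qed
  then obtain p q where pq: "\<And>k::nat. act (c [^] k) a = lc (p k) a (q k) b" by metis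
  have norm: "p k * p k + 2 * B * (p k * q k) + q k * q k = 1" for k
  proof -
    have "bil (act (c [^] k) a) (act (c [^] k) a) = 1" using c root by (simp add: bil_act root_norm)
    then show ?thesis unfolding pq using root b B by (simp add: root_norm B_def algebra_simps)
  qed
  \<comment> \<open>The least eigenvalue of the form in the basis \<open>a\<close>,
    \<open>b\<close>; it bounds the coefficients of vectors of norm 1.\<close>
  define d where "d = 1 - \<bar>B\<bar>"
  have d: "0 < d" "d \<le> 1" using B by (auto simp: d_def)
  have cross: "\<bar>2 * B * (x * y)\<bar> \<le> \<bar>B\<bar> * (x * x + y * y)" for x y :: real
  proof -
    have "2 * \<bar>x * y\<bar> \<le> x * x + y * y"
      using sum_squares_bound[of "\<bar>x\<bar>" "\<bar>y\<bar>"] by (simp add: power2_eq_square abs_mult)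
    then have "\<bar>B\<bar> * (2 * \<bar>x * y\<bar>) \<le> \<bar>B\<bar> * (x * x + y * y)" by (intro mult_left_mono) auto
    then show ?thesis by (simp add: abs_mult algebra_simps)
  qed
  have bound: "d * (p k * p k + q k * q k) \<le> 1" for k
    using norm[of k] cross[of "p k" "q k"] unfolding d_def by (simp add: algebra_simps abs_le_iff)
  define M where "M = 1 / d"
  have M: "M \<ge> 1" using d by (simp add: M_def)
  have small: "\<bar>x\<bar> \<le> M" if "d * (x * x + y * y) \<le> 1" for x y
  proof -
    have "x * x + y * y \<le> M" using that d by (simp add: M_def field_simps)
    then have "x * x \<le> M" by (smt (verit) zero_le_square)
    also have "M \<le> M * M" using M by (simp add: mult_le_cancel_left1)
    finally have "\<bar>x\<bar> * \<bar>x\<bar> \<le> M * M" by simp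
    then show ?thesis using M power2_le_imp_le[of "\<bar>x\<bar>" M] by (simp add: power2_eq_square)
  qed
  have pM: "\<bar>p k\<bar> \<le> M" and qM: "\<bar>q k\<bar> \<le> M" for k
    using small[OF bound[of k]] small[of "q k" "p k"] bound[of k] by (auto simp: add.commute)
  obtain s where s: "0 < a s" using pos_root_coordinate[OF root] by blast
  \<comment> \<open>\<open>e\<close> is the coordinate at \<open>s\<close> of b - B a, the part of
    \<open>b\<close> orthogonal to \<open>a\<close>. \<open>E\<close> is the size of
    \<open>Q\<close> beyond which 2 |q' e| < a s holds below.\<close>
  define e where "e = b s - B * a s"
  define E where "E = 16 * e\<^sup>2 / ((1 - B\<^sup>2) * (a s)\<^sup>2)"
  have B2: "0 < 1 - B\<^sup>2" using B by (simp add: abs_square_less_1)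
  obtain N :: nat where N: "real N > max 2 E" using reals_Archimedean2 by blast
  define Q where "Q = real N * real N"
  \<comment> \<open>Cells of side 1/N in the coefficient plane. Infinitely many members of the orbit
    share a cell, and two members in one cell differ by a power of \<open>c\<close> that moves
    \<open>a\<close> only a little.\<close>
  define F where "F k = (\<lfloor>N * p k\<rfloor>, \<lfloor>N * q k\<rfloor>)" for k
  have "range F \<subseteq> {- \<lceil>N * M\<rceil> .. \<lceil>N * M\<rceil>} \<times> {- \<lceil>N * M\<rceil> .. \<lceil>N * M\<rceil>}"
  proof -
    have "- \<lceil>N * M\<rceil> \<le> \<lfloor>N * x\<rfloor> \<and> \<lfloor>N * x\<rfloor> \<le> \<lceil>N * M\<rceil>" if "\<bar>x\<bar> \<le> M" for x :: real
    proof -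
      have "\<bar>real N * x\<bar> \<le> N * M" using that by (simp add: abs_mult mult_left_mono)
      then show ?thesis by linarith
    qed
    then show ?thesis using pM qM by (auto simp: F_def)
  qed
  then have "finite (range F)" by (rule finite_subset) auto
  then obtain k0 where k0: "infinite {k \<in> UNIV. F k = F k0}"
    using pigeonhole_infinite[of UNIV F] by auto
  define K where "K = {k. F k = F k0 \<and> k0 < k}"
  have "infinite K"
  proof
    assume "finite K"
    moreover have "{k \<in> UNIV. F k = F k0} \<subseteq> K \<union> {..k0}" by (auto simp: K_def)
    ultimately show False using k0 by (meson finite_UnI finite_atMost finite_subset)
  qed
  \<comment> \<open>Write g = T a + q' (b - B a). The reflection in \<open>a\<close> only changes
    the sign of T, so |q' e| < T a s makes the coordinate at \<open>s\<close> positive for g and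
    negative for its image.\<close>
  have close: "act (c [^] (k - k0)) a \<in> inversions t" if k: "k \<in> K" for k
  proof -
    define g where "g = act (c [^] (k - k0)) a"
    have groot: "g \<in> roots" using c root by (simp add: g_def act_root)
    define T where "T = bil g a"
    define x where "x = p k - p k0"
    define y where "y = q k - q k0"
    have near: "\<bar>u - v\<bar> \<le> 1 / N" if "\<lfloor>N * u\<rfloor> = \<lfloor>N * v\<rfloor>" for u v :: real
    proof -
      have "\<bar>N * u - N * v\<bar> \<le> 1" using that by linarith
      then have "N * \<bar>u - v\<bar> \<le> 1" by (simp add: abs_mult flip: right_diff_distrib)
      then show ?thesis using N by (simp add: field_simps)
    qed
    have xy: "\<bar>x\<bar> \<le> 1 / N" "\<bar>y\<bar> \<le> 1 / N"
      using k near by (auto simp: K_def F_def x_def y_def)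
    have "k = k0 + (k - k0)" using k by (simp add: K_def)
    then have kk: "act (c [^] k) a = act (c [^] k0) g"
      using c by (metis act_mult g_def nat_pow_closed nat_pow_mult)
    have "T = bil (act (c [^] k) a) (act (c [^] k0) a)"
      unfolding kk T_def using c by (simp add: bil_act)
    also have "\<dots> = p k * p k0 + B * (p k * q k0 + q k * p k0) + q k * q k0"
      unfolding pq using root b B by (simp add: root_norm B_def algebra_simps)
    \<comment> \<open>Both sides are the squared norm of the difference of the two members of the
      orbit.\<close>
    finally have "2 - 2 * T = x * x + 2 * B * (x * y) + y * y"
      using norm[of k] norm[of k0] unfolding x_def y_def by (simp add: algebra_simps)
    also have "\<dots> \<le> x * x + y * y + \<bar>B\<bar> * (x * x + y * y)" using cross[of x y] by linarith
    also have "\<dots> \<le> 2 * (x * x + y * y)"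
      using B mult_left_le_one_le[of "x * x + y * y" "\<bar>B\<bar>"] by simp
    finally have "1 - T \<le> x * x + y * y" by simp
    also have "\<dots> \<le> (1 / N) * (1 / N) + (1 / N) * (1 / N)"
      using xy by (intro add_mono) (metis abs_ge_zero abs_mult_self_eq mult_mono' order_refl)+
    finally have T: "1 - T \<le> 2 / Q" by (simp add: Q_def field_simps)
    have NN: "Q > 4" "Q > E"
      unfolding Q_def
    proof -
      have "real N * N > 2 * 2" using N by (intro mult_strict_mono) auto
      then show "real N * N > 4" by simp
      have "real N \<le> real N * N" using N by (simp add: mult_le_cancel_left1)
      then show "real N * N > E" using N by linarith
    qed
    then have "2 / Q < 1 / 2" by (simp add: field_simps)
    then have Thalf: "T > 1 / 2" using T by linarith
    obtain p' q' where g: "g = lc p' a q' b" using pq g_def by blast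
    have T': "T = p' + q' * B" using root b B by (simp add: T_def g root_norm)
    have "p' * p' + 2 * B * (p' * q') + q' * q' = 1"
      using root_norm[OF groot] unfolding g using root b B by (simp add: root_norm B_def algebra_simps)
    then have qT: "q' * q' * (1 - B\<^sup>2) = 1 - T * T"
      by (simp add: T' power2_eq_square algebra_simps)
    then have "T * T \<le> 1" using B2 by (smt (verit) mult_nonneg_nonneg zero_le_square)
    then have "T \<le> 1" using Thalf mult_strict_mono[of 1 T 1 T] by linarith
    then have "(1 - T) * (1 + T) \<le> (1 - T) * 2" by (intro mult_left_mono) auto
    then have "q' * q' * (1 - B\<^sup>2) \<le> 4 / Q" using qT T by (simp add: algebra_simps)
    then have "(q' * q' * (1 - B\<^sup>2)) * (16 * e\<^sup>2) \<le> 4 / Q * (16 * e\<^sup>2)"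
      by (rule mult_right_mono) simp
    also have "\<dots> < 4 / Q * (Q * ((1 - B\<^sup>2) * (a s)\<^sup>2))"
    proof (rule mult_strict_left_mono)
      have "E * ((1 - B\<^sup>2) * (a s)\<^sup>2) < Q * ((1 - B\<^sup>2) * (a s)\<^sup>2)"
        using NN B2 s by (intro mult_strict_right_mono) auto
      then show "16 * e\<^sup>2 < Q * ((1 - B\<^sup>2) * (a s)\<^sup>2)"
        using B2 s by (simp add: E_def)
      show "0 < 4 / Q" using NN by simp
    qed
    also have "\<dots> = (1 - B\<^sup>2) * (4 * (a s)\<^sup>2)" using NN by (simp add: field_simps)
    finally have "(1 - B\<^sup>2) * (4 * (2 * q' * e)\<^sup>2) < (1 - B\<^sup>2) * (4 * (a s)\<^sup>2)"
      by (simp add: power2_eq_square algebra_simps)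
    then have "4 * (2 * q' * e)\<^sup>2 < 4 * (a s)\<^sup>2" by (simp only: mult_less_cancel_left_pos[OF B2])
    then have "(2 * q' * e)\<^sup>2 < (a s)\<^sup>2" by (rule mult_less_cancel_left_pos[THEN iffD1, rotated]) (rule zero_less_numeral)
    then have "\<bar>2 * q' * e\<bar> < a s" using less_imp_le[OF s] power2_less_imp_less[of "\<bar>2 * q' * e\<bar>" "a s"] by (simp only: power2_abs)
    moreover have "a s < 2 * (T * a s)" using Thalf s by simp
    ultimately have qe: "\<bar>q' * e\<bar> < T * a s" by (simp add: abs_mult)
    have gs: "g s = T * a s + q' * e" by (simp add: g T' e_def algebra_simps)
    then have "g s > 0" using qe by linarith
    then have "pos g" using root_pos_if_coordinate[OF groot] by blast
    moreover have "act t g s = - (T * a s) + q' * e"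
      unfolding t(2) reflection_apply T_def[symmetric] gs by simp
    then have "act t g s < 0" using qe by linarith
    then have "neg (act t g)" using root_neg_if_coordinate[OF act_root[OF t(1) groot]] by blast
    ultimately show ?thesis using groot by (simp add: inversions_def pos_roots_def flip: g_def)
  qed
  have "inj_on (\<lambda>k. act (c [^] (k - k0)) a) K"
  proof (rule inj_onI)
    fix i j assume "i \<in> K" "j \<in> K" "act (c [^] (i - k0)) a = act (c [^] (j - k0)) a"
    then show "i = j" using injD[OF inj, of "i - k0" "j - k0"] by (auto simp: K_def)
  qed
  then have "infinite ((\<lambda>k. act (c [^] (k - k0)) a) ` K)" using \<open>infinite K\<close> by (simp add: finite_image_iff)
  then show False using finite_inversions[OF t(1)] close by (meson finite_subset image_subsetI)
qed

text \<open>Conjugation by the reflection in \<open>a\<close> inverts \<open>c\<close> (this is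
  \<open>flip\<close>), whereas a power of \<open>c\<close> that fixes \<open>a\<close> commutes
  with that reflection. Such a power is therefore its own inverse, on the whole space and not only
  on the plane of the two roots.\<close>

lemma rotation_finite_order:
  assumes a: "a \<in> pos_roots" and b: "b \<in> roots" and ab: "\<bar>bil a b\<bar> < 1"
    and t: "t \<in> carrier G" "\<And>v. act t v = reflection a v"
    and u: "u \<in> carrier G" "\<And>v. act u v = reflection b v"
  shows "\<exists>n>0. \<forall>v. act ((t \<otimes> u) [^] (n::nat)) v = v"
proof -
  define c where "c = t \<otimes> u"
  have c: "c \<in> carrier G" using t u by (simp add: c_def)
  obtain n :: nat where n: "n > 0" "act (c [^] n) a = a"
    using rotation_has_fixed_root[OF assms] by (auto simp: c_def)
  have root: "a \<in> roots" using a by (auto simp: pos_roots_def)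
  have inv2: "reflection a (reflection a v) = v" "reflection b (reflection b v) = v" for v
    using root b by (simp_all add: reflection_involution root_norm)
  have ac: "act c v = reflection a (reflection b v)" for v
    using t u by (simp add: c_def act_mult)
  have flip: "reflection a (act (c [^] k) (reflection a (act (c [^] k) v))) = v" for k :: nat and v
  proof (induction k arbitrary: v)
    case 0
    show ?case by (simp add: inv2)
  next
    case (Suc k)
    have "act (c [^] Suc k) w = act (c [^] k) (act c w)" for w using c by (simp add: act_mult)
    then have "act (c [^] Suc k) (reflection a (act (c [^] Suc k) v))
        = act (c [^] k) (act c (reflection a (act c (act (c [^] k) v))))"
      using act_pow_Suc[OF c] by simp
    also have "act c (reflection a (act c (act (c [^] k) v))) = reflection a (act (c [^] k) v)"
      by (simp add: ac inv2)
    finally show ?case using Suc by simp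
  qed
  have comm: "act (c [^] n) (reflection a v) = reflection a (act (c [^] n) v)" for v
  proof -
    have "bil (act (c [^] n) v) a = bil v a"
      using bil_act[of "c [^] n" v a] c n by simp
    then show ?thesis using n by (simp add: reflection_def act_lc)
  qed
  have "act (c [^] (n + n)) v = v" for v
  proof -
    have "act (c [^] (n + n)) v = act (c [^] n) (act (c [^] n) v)"
      using c by (simp add: act_mult flip: nat_pow_mult)
    also have "\<dots> = v" using flip[of n v] by (simp add: comm inv2)
    finally show ?thesis .
  qed
  then show ?thesis using n(1) unfolding c_def by (intro exI[of _ "n + n"]) auto
qed

section \<open>Linear forms, the fundamental chamber and finite subsystems\<close>

definition linear_form :: "(('a \<Rightarrow> real) \<Rightarrow> real) \<Rightarrow> bool" where
  "linear_form x \<longleftrightarrow> (\<forall>p u q v. x (lc p u q v) = p * x u + q * x v)"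

lemma linear_form_expand:
  assumes "linear_form x" "finite T" "\<And>z. z \<notin> T \<Longrightarrow> v z = 0"
  shows "x v = (\<Sum>s\<in>T. v s * x (simple s))"
  using assms(2,3)
proof (induction T arbitrary: v rule: finite_induct)
  case empty
  then have "v = lc 0 v 0 v" by (auto simp: fun_eq_iff)
  then have "x v = 0 * x v + 0 * x v" using assms(1) unfolding linear_form_def by metis
  then show ?case by simp
next
  case (insert r T)
  have "v = lc 1 (v(r := 0)) (v r) (simple r)" by (auto simp: fun_eq_iff simple_def)
  then have "x v = x (v(r := 0)) + v r * x (simple r)"
    using assms(1) unfolding linear_form_def by (metis mult_1)
  also have "x (v(r := 0)) = (\<Sum>s\<in>T. (v(r := 0)) s * x (simple s))"
    using insert.prems by (intro insert.IH) auto
  also have "\<dots> = (\<Sum>s\<in>T. v s * x (simple s))"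
    using insert.hyps by (intro sum.cong) auto
  finally show ?case using insert.hyps by simp
qed

lemma linear_form_act: "linear_form x \<Longrightarrow> linear_form (\<lambda>v. x (act g v))"
  by (simp add: linear_form_def act_lc)

lemma linear_form_uminus: "linear_form x \<Longrightarrow> x (\<lambda>z. - v z) = - x v"
  unfolding linear_form_def by (drule spec[of _ "-1"], drule spec[of _ v], drule spec[of _ 0], drule spec[of _ v]) (simp add: lc_def)

definition height :: "('a \<Rightarrow> real) \<Rightarrow> real" where "height v = (\<Sum>s\<in>S. v s)"

lemma linear_form_height: "linear_form height"
  by (simp add: linear_form_def height_def sum.distrib sum_distrib_left)

lemma height_pos:
  assumes "a \<in> roots" "pos a" shows "0 < height a"
proof (rule ccontr)
  assume *: "\<not> ?thesis"
  have nn: "0 \<le> a s" for s using assms(2) by (simp add: pos_def)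
  then have "height a = 0" using * sum_nonneg[of S a] by (simp add: height_def)
  then have "\<forall>s\<in>S. a s = 0" using nn finite_S by (simp add: height_def sum_nonneg_eq_0_iff)
  then have "a z = 0" for z using root_outside[OF assms(1), of z] by (cases "z \<in> S") auto
  then have "neg a" by (simp add: neg_def)
  then show False using assms root_sign by blast
qed

text \<open>Averaging the height over the finite dihedral group generated by the two reflections gives a
  form that it fixes, and which therefore vanishes at both roots.\<close>

lemma ex_vanishing_form:
  assumes a: "a \<in> pos_roots" and b: "b \<in> roots" and ab: "\<bar>bil a b\<bar> < 1"
  shows "\<exists>x. linear_form x \<and> x a = 0 \<and> x b = 0 \<and> finite {v \<in> pos_roots. x v \<le> 0}"
proof -
  have root: "a \<in> roots" using a by (auto simp: pos_roots_def)
  obtain t where t: "t \<in> carrier G" "\<And>v. act t v = reflection a v" using ex_reflection[OF root] by blast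
  obtain u where u: "u \<in> carrier G" "\<And>v. act u v = reflection b v" using ex_reflection[OF b] by blast
  define c where "c = t \<otimes> u"
  have c: "c \<in> carrier G" using t u by (simp add: c_def)
  obtain n :: nat where n: "n > 0" "\<And>v. act (c [^] n) v = v"
    using rotation_finite_order[OF a b ab t u] by (auto simp: c_def)
  define y where "y v = (\<Sum>k<n. height (act (c [^] k) v))" for v
  \<comment> \<open>The sum over the powers makes \<open>y\<close> invariant under the rotation
    \<open>c\<close>; adding its composition with one reflection makes \<open>x\<close> invariant
    under both reflections.\<close>
  define x where "x v = y v + y (reflection b v)" for v
  have inv2: "reflection a (reflection a v) = v" "reflection b (reflection b v) = v" for v
    using root b by (simp_all add: reflection_involution root_norm)
  have ac: "act c v = reflection a (reflection b v)" for v
    using t u by (simp add: c_def act_mult)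
  have yc: "y (reflection a (reflection b v)) = y v" for v
  proof -
    have "y (act c v) = (\<Sum>k<n. height (act (c [^] Suc k) v))"
      using c by (simp add: y_def act_mult)
    also have "\<dots> = y v"
      using sum.lessThan_Suc_shift[of "\<lambda>k. height (act (c [^] k) v)" n] n(2)[of v]
      by (simp add: y_def)
    finally show ?thesis by (simp add: ac)
  qed
  have "y (reflection a v) = y (reflection b v)" for v
    using yc[of "reflection b v"] by (simp add: inv2)
  moreover have "y (reflection b (reflection a v)) = y v" for v
    using yc[of "reflection b (reflection a v)"] by (simp add: inv2)
  ultimately have xab: "x (reflection a v) = x v" "x (reflection b v) = x v" for v
    by (simp_all add: x_def inv2)
  have y: "linear_form y"
    using linear_form_act[OF linear_form_height]
    by (simp add: linear_form_def y_def sum.distrib sum_distrib_left)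
  then have x: "linear_form x"
    by (simp add: linear_form_def x_def reflection_lc algebra_simps)
  \<comment> \<open>Each reflection negates its own root, so invariance gives x a = - x a.\<close>
  have "x a = 0" "x b = 0"
    using xab(1)[of a] xab(2)[of b] root b linear_form_uminus[OF x]
    by (simp_all add: reflection_self root_norm)
  moreover have "{v \<in> pos_roots. x v \<le> 0} \<subseteq> (\<Union>k<n. inversions (c [^] k) \<union> inversions (c [^] k \<otimes> u))"
  proof (rule ccontr)
    assume "\<not> ?thesis"
    then obtain v where v: "v \<in> pos_roots" "x v \<le> 0"
      "\<And>k. k < n \<Longrightarrow> \<not> neg (act (c [^] k) v)" "\<And>k. k < n \<Longrightarrow> \<not> neg (act (c [^] k \<otimes> u) v)"
      by (auto simp: inversions_def)
    have vr: "v \<in> roots" using v by (simp add: pos_roots_def)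
    have "height (act (c [^] k) v) > 0" "height (act (c [^] k) (reflection b v)) > 0" if "k < n" for k
    proof -
      have "pos (act (c [^] k) v)" "pos (act (c [^] k \<otimes> u) v)"
        using v(3,4)[OF that] vr c u root_sign act_root by (metis nat_pow_closed m_closed)+
      then show "height (act (c [^] k) v) > 0" "height (act (c [^] k) (reflection b v)) > 0"
        using height_pos[of "act (c [^] k) v"] height_pos[of "act (c [^] k \<otimes> u) v"]
          act_root[of "c [^] k \<otimes> u" v] vr c u
        by (simp_all add: act_root act_mult)
    qed
    then have "y v > 0" "y (reflection b v) > 0"
      unfolding y_def using n(1) by (auto intro!: sum_pos simp: lessThan_empty_iff)
    then show False using v(2) by (simp add: x_def)
  qed
  then have "finite {v \<in> pos_roots. x v \<le> 0}"
    by (rule finite_subset) (use c u finite_inversions in auto)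
  ultimately show ?thesis using x by blast
qed

text \<open>Moves \<open>x\<close> into the fundamental chamber. Take \<open>w\<close> with the
  fewest positive roots of negative value; as \<open>s\<close> permutes the positive roots other
  than \<open>simple s\<close>, a negative value at \<open>simple s\<close> would make
  \<open>w \<otimes> s\<close> better.\<close>

lemma ex_dominant:
  assumes x: "linear_form x" and fin: "finite {v \<in> pos_roots. x v \<le> 0}"
  shows "\<exists>w \<in> carrier G. (\<forall>s \<in> S. 0 \<le> x (act w (simple s))) \<and> finite {v \<in> pos_roots. x (act w v) \<le> 0}"
proof -
  \<comment> \<open>\<open>w\<close> makes only finitely many positive roots negative, so finiteness
    survives the composition.\<close>
  have finw: "finite {v \<in> pos_roots. x (act w v) \<le> 0}" if w: "w \<in> carrier G" for w
  proof -
    have inj: "inj (act w)" by (rule inj_on_inverseI[of _ "act (inv w)"]) (use w in simp)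
    have "{v \<in> pos_roots. x (act w v) \<le> 0} \<subseteq> inversions w \<union> act w -` {v \<in> pos_roots. x v \<le> 0}"
      using w act_root root_sign by (fastforce simp: inversions_def pos_roots_def)
    moreover have "finite (act w -` {v \<in> pos_roots. x v \<le> 0})" using fin inj by (rule finite_vimageI)
    ultimately show ?thesis using finite_inversions[OF w] by (meson finite_UnI finite_subset)
  qed
  let ?N = "\<lambda>w. {v \<in> pos_roots. x (act w v) < 0}"
  have finN: "finite (?N w)" if "w \<in> carrier G" for w
    by (rule finite_subset[OF _ finw[OF that]]) auto
  obtain w where w: "w \<in> carrier G" "\<And>g. g \<in> carrier G \<Longrightarrow> card (?N w) \<le> card (?N g)"
    using ex_has_least_nat[of "\<lambda>w. w \<in> carrier G" \<one> "\<lambda>w. card (?N w)"] by blast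
  have "0 \<le> x (act w (simple s))" if s: "s \<in> S" for s
  proof (rule ccontr)
    assume neg: "\<not> ?thesis"
    have inv2: "srefl s (srefl s v) = v" for v using s by (simp add: reflection_involution)
    have ws: "act (w \<otimes> s) v = act w (srefl s v)" for v using w s by (simp add: act_mult act_S)
    have "srefl s ` ?N (w \<otimes> s) \<subseteq> ?N w - {simple s}"
    proof
      fix v' assume "v' \<in> srefl s ` ?N (w \<otimes> s)"
      then obtain v where v: "v' = srefl s v" "v \<in> pos_roots" "x (act w (srefl s v)) < 0" by (auto simp: ws)
      have "v \<noteq> simple s"
      proof
        assume "v = simple s"
        then have "x (act w (srefl s v)) = - x (act w (simple s))"
          using s by (simp add: reflection_self act_uminus linear_form_uminus[OF x])
        then show False using v(3) neg by simp
      qed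
      then have "v' \<in> pos_roots"
        using simple_reflection_pos[of v s] act_root[of s v] v s by (simp add: pos_roots_def act_S)
      moreover have "v' \<noteq> simple s"
      proof
        assume "v' = simple s"
        then have "v = srefl s (simple s)" using inv2 v(1) by metis
        then have "neg v" using s by (simp add: reflection_self)
        then show False using v(2) root_sign by (auto simp: pos_roots_def)
      qed
      ultimately show "v' \<in> ?N w - {simple s}" using v by simp
    qed
    then have "card (srefl s ` ?N (w \<otimes> s)) \<le> card (?N w - {simple s})"
      using finN w by (intro card_mono) auto
    also have "card (srefl s ` ?N (w \<otimes> s)) = card (?N (w \<otimes> s))"
      by (intro card_image inj_on_inverseI[of _ "srefl s"]) (simp add: inv2)
    also have "card (?N w - {simple s}) < card (?N w)"
      using finN w neg s by (intro card_Diff1_less) (auto simp: pos_roots_def simple_root)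
    finally show False using w(2)[of "w \<otimes> s"] w(1) s by simp
  qed
  then show ?thesis using w finw by blast
qed

definition parabolic_roots :: "'a set \<Rightarrow> ('a \<Rightarrow> real) set" where
  "parabolic_roots J = {a \<in> roots. \<forall>z. z \<notin> J \<longrightarrow> a z = 0}"

text \<open>Being indexed by subsets of \<open>S\<close>, this set is finite without any
  classification of the finite subsystems.\<close>

definition finite_angles :: "real set" where
  "finite_angles = (\<Union>J \<in> {J \<in> Pow S. finite (parabolic_roots J)}.
     (\<lambda>(u, v). bil u v) ` (parabolic_roots J \<times> parabolic_roots J))"

lemma finite_finite_angles: "finite finite_angles"
  unfolding finite_angles_def using finite_S by auto

text \<open>Take the form of \<open>ex_vanishing_form\<close>, moved into the fundamental chamber.
  It has non-negative values on simple roots, so nothing cancels and it vanishes exactly on the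
  roots supported on \<open>J\<close>. Only finitely many positive roots have value at most 0, so
  there are finitely many such roots, and the images of \<open>a\<close> and \<open>b\<close> are
  among them.\<close>

lemma bil_finite_angles:
  assumes a: "a \<in> pos_roots" and b: "b \<in> roots" and ab: "\<bar>bil a b\<bar> < 1"
  shows "bil a b \<in> finite_angles"
proof -
  obtain x where x: "linear_form x" "x a = 0" "x b = 0" "finite {v \<in> pos_roots. x v \<le> 0}"
    using ex_vanishing_form[OF assms] by blast
  obtain w where w: "w \<in> carrier G" "\<And>s. s \<in> S \<Longrightarrow> 0 \<le> x (act w (simple s))"
    "finite {v \<in> pos_roots. x (act w v) \<le> 0}"
    using ex_dominant[OF x(1,4)] by blast
  define y where "y v = x (act w v)" for v
  have y: "linear_form y" using linear_form_act[OF x(1)] unfolding y_def .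
  define J where "J = {s \<in> S. y (simple s) = 0}"
  have supp_pos: "v \<in> parabolic_roots J" if v: "v \<in> roots" "pos v" "y v = 0" for v
  proof -
    have "(\<Sum>s\<in>S. v s * y (simple s)) = 0"
      using linear_form_expand[OF y finite_S, of v] root_outside v by simp
    moreover have "0 \<le> v s * y (simple s)" if "s \<in> S" for s
      using v(2) w(2)[OF that] by (simp add: pos_def y_def)
    ultimately have "\<forall>s\<in>S. v s * y (simple s) = 0"
      using finite_S by (simp add: sum_nonneg_eq_0_iff)
    then have "v z = 0" if "z \<notin> J" for z
      using root_outside[OF v(1)] that by (cases "z \<in> S") (auto simp: J_def)
    then show ?thesis using v(1) by (simp add: parabolic_roots_def)
  qed
  have supp: "v \<in> parabolic_roots J" if v: "v \<in> roots" "y v = 0" for v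
  proof (cases "pos v")
    case True
    then show ?thesis using supp_pos v by blast
  next
    case False
    then have "(\<lambda>z. - v z) \<in> parabolic_roots J"
      using supp_pos[of "\<lambda>z. - v z"] uminus_root v root_sign by (simp add: linear_form_uminus[OF y])
    then show ?thesis using v by (simp add: parabolic_roots_def)
  qed
  have y0: "y v = 0" if "v \<in> parabolic_roots J" for v
  proof -
    have "y v = (\<Sum>s\<in>J. v s * y (simple s))"
      using that finite_S by (intro linear_form_expand[OF y]) (auto simp: parabolic_roots_def J_def)
    then show ?thesis by (simp add: J_def)
  qed
  let ?P = "{v \<in> pos_roots. y v \<le> 0}"
  have "parabolic_roots J \<subseteq> ?P \<union> (\<lambda>v z. - v z) ` ?P"
  proof
    fix v assume v: "v \<in> parabolic_roots J"
    then have r: "v \<in> roots" by (simp add: parabolic_roots_def)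
    show "v \<in> ?P \<union> (\<lambda>v z. - v z) ` ?P"
    proof (cases "pos v")
      case True
      then show ?thesis using r y0[OF v] by (simp add: pos_roots_def)
    next
      case False
      then have "(\<lambda>z. - v z) \<in> ?P"
        using uminus_root[OF r] r root_sign y0[OF v] by (simp add: pos_roots_def linear_form_uminus[OF y])
      then show ?thesis by (intro UnI2 image_eqI[of _ _ "\<lambda>z. - v z"]) auto
    qed
  qed
  moreover have "finite ?P" using w(3) by (simp add: y_def)
  ultimately have "finite (parabolic_roots J)" by (meson finite_UnI finite_imageI finite_subset)
  then have J: "J \<in> {J \<in> Pow S. finite (parabolic_roots J)}" by (auto simp: J_def)
  have "act (inv w) a \<in> parabolic_roots J" "act (inv w) b \<in> parabolic_roots J"
    using w(1) x a b by (auto intro!: supp act_root simp: y_def pos_roots_def)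
  moreover have "bil a b = bil (act (inv w) a) (act (inv w) b)"
    using w(1) by (simp add: bil_act)
  ultimately show ?thesis
    unfolding finite_angles_def using J by (intro UN_I[OF J] image_eqI[of _ _ "(act (inv w) a, act (inv w) b)"]) auto
qed

section \<open>Finiteness of the set of small roots\<close>

text \<open>The norm 1 of \<open>a\<close> is a combination of its pairings with the simple roots,
  with non-negative weights.\<close>

lemma ex_positive_pairing:
  assumes "a \<in> pos_roots" shows "\<exists>s \<in> S. 0 < bil a (simple s)"
proof (rule ccontr)
  assume *: "\<not> ?thesis"
  have "bil a a \<le> 0"
    unfolding bil_eq_sum[of a a]
    using * assms by (intro sum_nonpos mult_nonneg_nonpos) (auto simp: pos_roots_def pos_def not_less)
  then show False using assms root_norm by (auto simp: pos_roots_def)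
qed

text \<open>Nothing bounds the number of pairings below -1 a priori, so truncation merges them. For
  a small root the remaining values are 1 or lie in \<open>finite_angles\<close>.\<close>

definition type_vector :: "('a \<Rightarrow> real) \<Rightarrow> 'a \<Rightarrow> real" where
  "type_vector a = (\<lambda>s. if s \<in> S then max (bil a (simple s)) (- 1) else 0)"

lemma small_root_simple_less_1:
  assumes "a \<in> small_roots" "s \<in> S" "a \<noteq> simple s"
  shows "bil a (simple s) < 1"
  using small_roots_bil_less_1[OF assms(1) simple_small[OF assms(2)] assms(3)] .

lemma finite_type_vectors: "finite (type_vector ` small_roots)"
proof -
  let ?V = "insert 1 (insert (- 1) finite_angles)"
  have "type_vector a s \<in> ?V" if a: "a \<in> small_roots" and s: "s \<in> S" for a s
  proof (cases "a = simple s \<or> bil a (simple s) \<le> - 1")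
    case True
    then show ?thesis using s by (auto simp: type_vector_def max_def)
  next
    case False
    then have "\<bar>bil a (simple s)\<bar> < 1" using small_root_simple_less_1[OF a s] by auto
    then have "bil a (simple s) \<in> finite_angles"
      using a s by (intro bil_finite_angles) (auto simp: small_roots_def simple_root)
    then show ?thesis using False s by (simp add: type_vector_def)
  qed
  then have "type_vector ` small_roots \<subseteq> {f. \<forall>x. (x \<in> S \<longrightarrow> f x \<in> ?V) \<and> (x \<notin> S \<longrightarrow> f x = 0)}"
  proof (intro image_subsetI CollectI allI conjI impI)
    show "type_vector a x = 0" if "x \<notin> S" for a x using that by (simp add: type_vector_def)
  qed blast
  then show ?thesis
    by (rule finite_subset) (intro finite_set_of_finite_funs, use finite_S finite_finite_angles in auto)
qed

text \<open>Between two roots of the same type in a descending chain no coordinate changes at which the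
  truncation at \<open>-1\<close> is effective: reflecting there would lead from a pairing \<open>\<ge> 1\<close> with a simple
  root, which a small root does not have. So the difference of the two roots is orthogonal to both,
  their inner product is \<open>1\<close>, and one dominates the other.\<close>

lemma descending_chain_types:
  assumes small: "\<And>i. i \<le> n \<Longrightarrow> f i \<in> small_roots"
    and nonsimple: "\<And>i s. i \<le> n \<Longrightarrow> s \<in> S \<Longrightarrow> f i \<noteq> simple s"
    and step: "\<And>i. i < n \<Longrightarrow> \<exists>s \<in> S. 0 < bil (f i) (simple s) \<and> f (Suc i) = srefl s (f i)"
    and ij: "i < j" "j \<le> n"
  shows "type_vector (f i) \<noteq> type_vector (f j)"
proof
  assume same: "type_vector (f i) = type_vector (f j)"
  have eq: "f i r = f j r \<or> bil (f i) (simple r) = bil (f j) (simple r)" if r: "r \<in> S" for r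
  proof (cases "bil (f j) (simple r) \<le> - 1")
    case False
    have "max (bil (f i) (simple r)) (- 1) = max (bil (f j) (simple r)) (- 1)"
      using fun_cong[OF same, of r] r by (simp add: type_vector_def)
    then show ?thesis using False by (auto simp: max_def split: if_splits)
  next
    case True
    have "i \<le> j" using ij by simp
    \<comment> \<open>Backwards from \<open>j\<close>: undoing a reflection in another simple root
      can only lower the pairing with \<open>simple r\<close>, because off-diagonal entries are
      non-positive, and it does not touch the coordinate at \<open>r\<close>.\<close>
    then have "bil (f i) (simple r) \<le> - 1 \<and> f i r = f j r"
    proof (induction rule: inc_induct)
      case base
      then show ?case using True by simp
    next
      case (step k)
      then have k: "k < n" using ij by simp
      then obtain x where x: "x \<in> S" "0 < bil (f k) (simple x)" "f (Suc k) = srefl x (f k)"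
        using assms(3) by blast
      have "x \<noteq> r"
      proof
        assume "x = r"
        then have "bil (f (Suc k)) (simple r) = - bil (f k) (simple r)"
          using x r by (simp add: reflection_def)
        then have "1 \<le> bil (f k) (simple r)" using step.IH by simp
        then show False using small_root_simple_less_1[of "f k" r] small nonsimple k r by fastforce
      qed
      then have "bil (f (Suc k)) (simple r) = bil (f k) (simple r) - 2 * bil (f k) (simple x) * cos_entry x r"
        using x r by (simp add: reflection_def)
      moreover have "bil (f k) (simple x) * cos_entry x r \<le> 0"
        using x r \<open>x \<noteq> r\<close> cos_entry_nonpos[of x r] by (simp add: mult_nonneg_nonpos)
      ultimately show ?case using step.IH x(3) refl_outside[of r x "f k"] \<open>x \<noteq> r\<close> by auto
    qed
    then show ?thesis by simp
  qed
  \<comment> \<open>In every summand the first factor vanishes or the second factors agree. The sums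
    are pairings of the difference with \<open>f i\<close> and with \<open>f j\<close>.\<close>
  have "(\<Sum>r\<in>S. (f i r - f j r) * bil (f i) (simple r)) = (\<Sum>r\<in>S. (f i r - f j r) * bil (f j) (simple r))"
    using eq by (intro sum.cong) auto
  then have "bil (f i) (f i) - bil (f j) (f i) = bil (f i) (f j) - bil (f j) (f j)"
    by (simp add: left_diff_distrib sum_subtractf bil_eq_sum[symmetric])
  moreover have norm: "bil (f k) (f k) = 1" if "k \<le> n" for k
    using small[OF that] by (simp add: small_roots_def pos_roots_def root_norm)
  ultimately have one: "bil (f i) (f j) = 1" using ij bil_sym[of "f j" "f i"] by simp
  have dec: "height (f (Suc k)) < height (f k)" if k: "k < n" for k
  proof -
    obtain x where x: "x \<in> S" "0 < bil (f k) (simple x)" "f (Suc k) = srefl x (f k)"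
      using step[OF k] by blast
    have "height (simple x) = 1" using x(1) finite_S by (simp add: height_def simple_def)
    moreover have "height (srefl x (f k)) = height (f k) - 2 * bil (f k) (simple x) * height (simple x)"
      using linear_form_height by (simp add: reflection_def linear_form_def)
    ultimately show ?thesis using x by simp
  qed
  have "height (f j) < height (f i)"
    using ij
  proof (induction j rule: less_Suc_induct)
    case (1 k)
    then show ?case by (intro dec) simp
  qed auto
  then have "f i \<noteq> f j" by auto
  then show False using small_roots_bil_less_1[of "f i" "f j"] small ij one by simp
qed

theorem finite_small_roots: "finite small_roots"
proof -
  \<comment> \<open>Simple roots are fixed, so that a sequence of iterates stays where it has
    arrived.\<close>
  define down where "down a = (if a \<in> simple ` S then a
      else srefl (SOME s. s \<in> S \<and> 0 < bil a (simple s)) a)" for a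
  have down: "\<exists>s \<in> S. 0 < bil a (simple s) \<and> down a = srefl s a"
    if "a \<in> small_roots" "a \<notin> simple ` S" for a
  proof -
    have "\<exists>s. s \<in> S \<and> 0 < bil a (simple s)"
      using that ex_positive_pairing[of a] by (auto simp: small_roots_def)
    from someI_ex[OF this] show ?thesis using that by (auto simp: down_def)
  qed
  have small: "(down ^^ i) a \<in> small_roots" if "a \<in> small_roots" for a i
  proof (induction i)
    case (Suc i)
    show ?case
    proof (cases "(down ^^ i) a \<in> simple ` S")
      case True
      then have "down ((down ^^ i) a) = (down ^^ i) a" unfolding down_def by (rule if_P)
      then show ?thesis using Suc by simp
    next
      case False
      then obtain s where s: "s \<in> S" "0 < bil ((down ^^ i) a) (simple s)"
        "down ((down ^^ i) a) = srefl s ((down ^^ i) a)"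
        using down[OF Suc] by blast
      moreover have "(down ^^ i) a \<noteq> simple s" using False s(1) by blast
      ultimately show ?thesis using small_descent[OF Suc] by simp
    qed
  qed (use that in simp)
  \<comment> \<open>If the iterates 0 to K all avoided the simple roots, they would have K + 1
    distinct types.\<close>
  define K where "K = card (type_vector ` small_roots)"
  have hit: "\<exists>i \<le> K. (down ^^ i) a \<in> simple ` S" if a: "a \<in> small_roots" for a
  proof (rule ccontr)
    assume no: "\<not> ?thesis"
    define f where "f i = (down ^^ i) a" for i
    have "type_vector (f i) \<noteq> type_vector (f j)" if "i < j" "j \<le> K" for i j
    proof (rule descending_chain_types[of K f])
      fix k assume "k < K"
      then show "\<exists>s \<in> S. 0 < bil (f k) (simple s) \<and> f (Suc k) = srefl s (f k)"
        using down[of "f k"] small[OF a] no by (simp add: f_def)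
    qed (use small[OF a] no that in \<open>auto simp: f_def\<close>)
    then have "inj_on (\<lambda>i. type_vector (f i)) {..K}"
      by (intro linorder_inj_onI) auto
    then have "card {..K} \<le> K"
      unfolding K_def using small[OF a] finite_type_vectors by (intro card_inj_on_le) (auto simp: f_def)
    then show False by simp
  qed
  have word: "\<exists>w. set w \<subseteq> S \<and> length w \<le> i \<and> a = word_act w (simple s)"
    if "a \<in> small_roots" "(down ^^ i) a = simple s" for a i s
    using that
  proof (induction i arbitrary: a)
    case 0
    then show ?case by (intro exI[of _ "[]"]) auto
  next
    case (Suc i)
    have "down a \<in> small_roots" using small[OF Suc.prems(1), of 1] by simp
    moreover have "(down ^^ i) (down a) = simple s" using Suc.prems(2) by (simp add: funpow_swap1)
    ultimately obtain w where w: "set w \<subseteq> S" "length w \<le> i" "down a = word_act w (simple s)"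
      using Suc.IH by blast
    show ?case
    proof (cases "a \<in> simple ` S")
      case True
      then show ?thesis using w by (intro exI[of _ w]) (auto simp: down_def)
    next
      case False
      then obtain r where r: "r \<in> S" "down a = srefl r a" using down Suc.prems(1) by blast
      then have "a = srefl r (down a)" by (simp add: reflection_involution)
      then show ?thesis using w r by (intro exI[of _ "r # w"]) auto
    qed
  qed
  have "small_roots \<subseteq> (\<lambda>(w, s). word_act w (simple s)) ` ({w. set w \<subseteq> S \<and> length w \<le> K} \<times> S)"
  proof
    fix a assume a: "a \<in> small_roots"
    then obtain i s where i: "i \<le> K" "s \<in> S" "(down ^^ i) a = simple s" using hit by blast
    then obtain w where "set w \<subseteq> S" "length w \<le> i" "a = word_act w (simple s)" using word a by blast
    then show "a \<in> (\<lambda>(w, s). word_act w (simple s)) ` ({w. set w \<subseteq> S \<and> length w \<le> K} \<times> S)"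
      using i by (intro image_eqI[of _ _ "(w, s)"]) auto
  qed
  then show ?thesis
    by (rule finite_subset) (use finite_S finite_lists_length_le in auto)
qed

section \<open>Cone types\<close>

definition cone :: "'a \<Rightarrow> 'a set" where
  "cone g = {h \<in> carrier G. len (g \<otimes> h) = len g + len h}"

lemma one_in_cone: "g \<in> carrier G \<Longrightarrow> \<one> \<in> cone g"
  by (simp add: cone_def)

lemma descent_iff_neg:
  assumes "g \<in> carrier G" "s \<in> S"
  shows "len (g \<otimes> s) < len g \<longleftrightarrow> neg (act g (simple s))"
  using act_simple_neg[OF assms] act_simple_pos[OF assms] root_sign[OF rootI[OF assms]]
    len_mult_S_neq[OF assms] by linarith

text \<open>Along a reduced word of \<open>h\<close>, the letter at which \<open>a\<close> changes
  sign shortens the product with \<open>g\<close> instead of lengthening it.\<close>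

lemma common_inversion_not_cone:
  assumes g: "g \<in> carrier G" and h: "h \<in> carrier G"
    and a: "a \<in> pos_roots" "neg (act g a)" "neg (act (inv h) a)"
  shows "h \<notin> cone g"
proof -
  obtain w where w: "set w \<subseteq> S" "val w = h" "length w = len h" using ex_reduced[OF h] by blast
  have "neg (word_act (rev w) a)"
    using a(3) w inv_val[of w] act_val[of "rev w"] by simp
  then have "\<exists>u x z. rev w = u @ x # z \<and> word_act z a = simple x"
    using w(1) a(1) by (intro word_act_sign_change) auto
  then obtain u x z where uxz: "rev w = u @ x # z" "word_act z a = simple x" by blast
  have set: "set u \<subseteq> S" "x \<in> S" "set z \<subseteq> S" using arg_cong[OF uxz(1), of set] w(1) by auto
  define p where "p = val (rev z)"
  have p: "p \<in> carrier G" "len p \<le> length z" using set len_le[of "rev z"] by (simp_all add: p_def)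
  have "w = rev z @ x # rev u" using arg_cong[OF uxz(1), of rev] by simp
  then have hp: "h = p \<otimes> x \<otimes> val (rev u)" using set w(2) by (simp add: p_def m_assoc)
  have "act (val z) a = simple x" using uxz(2) set by (simp add: act_val)
  then have "a = act p (simple x)" using set inv_val[of z] by (metis act_inv_cancel(1) p_def val_closed)
  then have "neg (act (g \<otimes> p) (simple x))" using a(2) g p by (simp add: act_mult)
  then have "len (g \<otimes> p \<otimes> x) < len (g \<otimes> p)" using descent_iff_neg g p set by simp
  moreover have "len (g \<otimes> p) \<le> len g + length z" using len_mult[OF g p(1)] p(2) by simp
  moreover have "len (g \<otimes> h) \<le> len (g \<otimes> p \<otimes> x) + length u"
  proof -
    have "g \<otimes> h = (g \<otimes> p \<otimes> x) \<otimes> val (rev u)" using g p set by (simp add: hp m_assoc)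
    then show ?thesis
      using len_mult[of "g \<otimes> p \<otimes> x" "val (rev u)"] len_le[of "rev u"] g p set by simp
  qed
  moreover have "len h = length u + length z + 1"
    using w(3) arg_cong[OF uxz(1), of length] by simp
  ultimately show ?thesis by (simp add: cone_def)
qed

text \<open>When \<open>h\<close> is built up letter by letter, the first letter \<open>s\<close>
  that fails to lengthen the product gives the root \<open>act h' (simple s)\<close>. Further
  letters keep it inverted.\<close>

lemma not_cone_common_inversion:
  assumes "g \<in> carrier G" "h \<in> carrier G" "h \<notin> cone g"
  shows "\<exists>a \<in> pos_roots. neg (act g a) \<and> neg (act (inv h) a)"
  using assms(2,3)
proof (induction "len h" arbitrary: h rule: less_induct)
  case less
  note g = assms(1) and h = less.prems(1)
  have "h \<noteq> \<one>" using less.prems one_in_cone g by auto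
  then obtain s where s: "s \<in> S" "len (h \<otimes> s) < len h" using ex_descent h by blast
  define h' where "h' = h \<otimes> s"
  have h': "h' \<in> carrier G" "h = h' \<otimes> s" using h s by (simp_all add: h'_def)
  have hinv: "act (inv h) v = srefl s (act (inv h') v)" for v
    using h' s by (simp add: inv_mult_group act_mult act_S)
  define a where "a = act h' (simple s)"
  have "pos a" unfolding a_def using act_simple_pos h' s by (simp add: h'_def[symmetric])
  then have a: "a \<in> pos_roots" using rootI[OF h'(1) s(1)] by (simp add: a_def pos_roots_def)
  show ?case
  proof (cases "h' \<in> cone g")
    case False
    then obtain b where b: "b \<in> pos_roots" "neg (act g b)" "neg (act (inv h') b)"
      using less.hyps[of h'] h'(1) s(2) unfolding h'_def by blast
    have br: "b \<in> roots" using b(1) by (simp add: pos_roots_def)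
    have b': "act (inv h') b \<in> roots" using h' br act_root by simp
    \<comment> \<open>\<open>s\<close> makes a negative root positive only if it is the negative of
      \<open>simple s\<close>. Then \<open>b\<close> would be the negative of \<open>a\<close>, but
      both are positive.\<close>
    have "neg (srefl s (act (inv h') b))"
    proof (rule ccontr)
      assume *: "\<not> ?thesis"
      define v where "v = (\<lambda>x. - act (inv h') b x)"
      have v: "v \<in> roots" "pos v" using uminus_root[OF b'] b(3) by (simp_all add: v_def)
      have "\<not> pos (srefl s v)"
        using * root_sign[of "srefl s (act (inv h') b)"] act_root[of s "act (inv h') b"] b' s
        by (simp add: v_def reflection_uminus act_S)
      then have "v = simple s" using simple_reflection_pos[OF v s(1)] by blast
      then have "act (inv h') b = (\<lambda>x. - simple s x)" by (simp add: v_def fun_eq_iff minus_equation_iff[of "act (inv h') b _"])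
      then have "act h' (act (inv h') b) = act h' (\<lambda>x. - simple s x)" by simp
      then have "b = (\<lambda>x. - a x)" using h' by (simp add: a_def act_uminus)
      then have "neg b" using \<open>pos a\<close> by simp
      then show False using b(1) root_sign by (auto simp: pos_roots_def)
    qed
    then show ?thesis using b hinv by auto
  next
    case True
    have gh: "g \<otimes> h = g \<otimes> h' \<otimes> s" using g h' s by (simp add: m_assoc)
    have "len h = len h' + 1" using s len_mult_S_cases[OF h s(1)] by (simp add: h'_def)
    then have "len (g \<otimes> h' \<otimes> s) \<noteq> len (g \<otimes> h') + 1"
      using True less.prems gh by (auto simp: cone_def)
    then have "len (g \<otimes> h' \<otimes> s) < len (g \<otimes> h')"
      using len_mult_S_cases[of "g \<otimes> h'" s] g h' s by auto
    then have "neg (act g a)" using act_simple_neg g h' s by (simp add: a_def act_mult[symmetric])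
    moreover have "neg (act (inv h) a)"
      unfolding hinv using h' s by (simp add: a_def reflection_self)
    ultimately show ?thesis using a by blast
  qed
qed

lemma cone_small_roots:
  assumes "g \<in> carrier G"
  shows "cone g = {h \<in> carrier G. \<forall>a \<in> small_roots \<inter> inversions g. \<not> neg (act (inv h) a)}"
proof (intro equalityI subsetI)
  fix h assume "h \<in> cone g"
  moreover from this have "h \<in> carrier G" by (simp add: cone_def)
  ultimately show "h \<in> {h \<in> carrier G. \<forall>a \<in> small_roots \<inter> inversions g. \<not> neg (act (inv h) a)}"
    using common_inversion_not_cone[OF assms] by (auto simp: inversions_def)
next
  fix h assume h: "h \<in> {h \<in> carrier G. \<forall>a \<in> small_roots \<inter> inversions g. \<not> neg (act (inv h) a)}"
  show "h \<in> cone g"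
  proof (rule ccontr)
    assume "h \<notin> cone g"
    then obtain a where a: "a \<in> pos_roots" "neg (act g a)" "neg (act (inv h) a)"
      using not_cone_common_inversion[OF assms] h by blast
    then obtain b where "b \<in> small_roots" "dominates a b" using ex_small_dominated by blast
    moreover from this have "b \<in> inversions g" "neg (act (inv h) b)"
      using a h assms by (auto simp: inversions_def dominates_def small_roots_def)
    ultimately show False using h by blast
  qed
qed

theorem finite_cones: "finite (cone ` carrier G)"
proof (rule finite_subset)
  show "cone ` carrier G \<subseteq>
    (\<lambda>A. {h \<in> carrier G. \<forall>a \<in> A. \<not> neg (act (inv h) a)}) ` Pow small_roots"
    using cone_small_roots by (intro image_subsetI) (auto intro!: image_eqI)
  show "finite ((\<lambda>A. {h \<in> carrier G. \<forall>a \<in> A. \<not> neg (act (inv h) a)}) ` Pow small_roots)"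
    using finite_small_roots by simp
qed

text \<open>Additivity of lengths for three factors may be bracketed either way, by the triangle
  inequality. The right-hand side depends on \<open>g\<close> only through \<open>cone g\<close>, so
  transitions between cone types are well defined.\<close>

lemma cone_mult:
  assumes "g \<in> carrier G" "h \<in> cone g"
  shows "cone (g \<otimes> h) = {x \<in> cone h. h \<otimes> x \<in> cone g}"
proof -
  have h: "h \<in> carrier G" "len (g \<otimes> h) = len g + len h" using assms(2) by (auto simp: cone_def)
  have "x \<in> cone (g \<otimes> h) \<longleftrightarrow> x \<in> cone h \<and> h \<otimes> x \<in> cone g" if x: "x \<in> carrier G" for x
    using len_mult[OF assms(1), of "h \<otimes> x"] len_mult[OF h(1) x] x h assms(1)
    by (auto simp: cone_def m_assoc)
  then show ?thesis by (auto simp: cone_def[of h] cone_def[of "g \<otimes> h"])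
qed

section \<open>Longest elements of descent groups\<close>

abbreviation descents :: "'a \<Rightarrow> 'a set" where "descents \<equiv> right_descents G S"

lemma descents_cone:
  assumes "g \<in> carrier G" shows "descents g = S - cone g"
proof -
  have "len (g \<otimes> s) < len g \<longleftrightarrow> s \<notin> cone g" if s: "s \<in> S" for s
  proof -
    have "len s = 1" using len_mult_S_neq[of \<one> s] len_S[OF s] s by simp
    then show ?thesis using len_mult_S_cases[OF assms s] s by (auto simp: cone_def)
  qed
  then show ?thesis by (auto simp: right_descents_def)
qed

lemma generate_carrier: "T \<subseteq> S \<Longrightarrow> x \<in> generate G T \<Longrightarrow> x \<in> carrier G"
  using generate_in_carrier S_carrier by blast

text \<open>For \<open>r\<close> outside \<open>T\<close>, \<open>x\<close> leaves the coordinate of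
  \<open>simple r\<close> at \<open>r\<close> equal to 1, whereas a descent would make it
  non-positive.\<close>

lemma ex_descent_generate:
  assumes "T \<subseteq> S" "x \<in> generate G T" "x \<noteq> \<one>"
  shows "\<exists>s \<in> T. len (x \<otimes> s) < len x"
proof -
  have x: "x \<in> carrier G" using generate_carrier assms by blast
  then obtain r where r: "r \<in> S" "len (x \<otimes> r) < len x" using ex_descent assms(3) by blast
  then have "act x (simple r) r \<le> 0" using act_simple_neg[OF x] by (auto simp: neg_def)
  moreover have "act x (simple r) r = 1" if "r \<notin> T"
    using act_outside[OF x that assms(1,2)] by (simp add: simple_def)
  ultimately show ?thesis using r by fastforce
qed

text \<open>Each letter that lengthens \<open>x\<close> shortens the product:
  \<open>act y (simple s)\<close> is a non-negative combination of simple roots in \<open>T\<close>,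
  all of which \<open>g\<close> makes negative. Lengths in the subgroup are thus bounded by
  \<open>len g\<close>, and this bound stands in for its finiteness.\<close>

lemma len_mult_generate_descents:
  assumes g: "g \<in> carrier G" and T: "T \<subseteq> descents g" and "x \<in> generate G T"
  shows "len (g \<otimes> x) + len x = len g"
  using assms(3)
proof (induction "len x" arbitrary: x rule: less_induct)
  case less
  have TS: "T \<subseteq> S" using T by (auto simp: right_descents_def)
  have x: "x \<in> carrier G" using generate_carrier TS less.prems by blast
  show ?case
  proof (cases "x = \<one>")
    case False
    then obtain s where s: "s \<in> T" "len (x \<otimes> s) < len x" using ex_descent_generate TS less.prems by blast
    then have sS: "s \<in> S" using TS by blast
    define y where "y = x \<otimes> s"
    have y: "y \<in> carrier G" "y \<in> generate G T" "x = y \<otimes> s" "len y < len x" "len x = len y + 1"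
      using x s sS less.prems generate.eng[OF less.prems generate.incl] len_mult_S_cases[OF x sS]
      by (auto simp: y_def)
    define v where "v = act y (simple s)"
    have v: "pos v" "\<And>z. z \<notin> T \<Longrightarrow> v z = 0"
      using act_simple_pos[OF y(1) sS] y act_outside[OF y(1) _ TS y(2)] s(1)
      by (auto simp: v_def) (auto simp: simple_def)
    have "act g v z \<le> 0" for z
    proof -
      have "linear_form (\<lambda>v. act g v z)" by (simp add: linear_form_def act_lc)
      then have "act g v z = (\<Sum>t\<in>T. v t * act g (simple t) z)"
        using v(2) finite_subset[OF TS finite_S] by (intro linear_form_expand)
      also have "\<dots> \<le> 0"
        using v(1) T act_simple_neg[OF g]
        by (intro sum_nonpos mult_nonneg_nonpos) (auto simp: pos_def neg_def right_descents_def)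
      finally show ?thesis .
    qed
    then have "neg (act (g \<otimes> y) (simple s))" using g y by (simp add: neg_def v_def act_mult)
    then have "len (g \<otimes> y \<otimes> s) < len (g \<otimes> y)" using descent_iff_neg g y sS by simp
    then have "len (g \<otimes> y) = len (g \<otimes> x) + 1"
      using len_mult_S_cases[of "g \<otimes> y" s] g y sS by (simp add: m_assoc)
    then show ?thesis using less.hyps[OF y(4,2)] y(5) by simp
  qed (use g in simp)
qed

abbreviation longest :: "'a \<Rightarrow> 'a" where "longest \<equiv> longest_descent G S"

lemma longest_cong: "descents g = descents h \<Longrightarrow> longest g = longest h"
  by (simp add: longest_descent_def)

text \<open>Maximality makes all of \<open>T\<close> descents of a longest \<open>x\<close>, so
  \<open>len_mult_generate_descents\<close> also applies to \<open>x\<close> in place of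
  \<open>g\<close>. For any longest \<open>y\<close> it shows that \<open>x \<otimes> y\<close> has
  length 0, hence \<open>y = inv x\<close>. This is uniqueness and, for \<open>y = x\<close>, the
  involution property.\<close>

lemma longest_properties:
  assumes g: "g \<in> carrier G"
  shows longest_closed: "longest g \<in> carrier G"
    and longest_involution: "longest g \<otimes> longest g = \<one>"
    and len_mult_longest: "len (g \<otimes> longest g) + len (longest g) = len g"
proof -
  define T where "T = descents g"
  have TS: "T \<subseteq> S" by (auto simp: T_def right_descents_def)
  note gen = len_mult_generate_descents[OF g, of T, unfolded T_def, OF order_refl, folded T_def]
  obtain x where x: "x \<in> generate G T" "\<And>y. y \<in> generate G T \<Longrightarrow> len y \<le> len x"
  proof -
    have "\<forall>y. y \<in> generate G T \<longrightarrow> len y < Suc (len g)" using gen by fastforce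
    then show ?thesis
      using that ex_has_greatest_nat[of "\<lambda>y. y \<in> generate G T" \<one> len "Suc (len g)"] generate.one by (metis less_imp_le)
  qed
  have xc: "x \<in> carrier G" using generate_carrier TS x(1) by blast
  have "T \<subseteq> descents x"
  proof
    fix s assume s: "s \<in> T"
    then have "len (x \<otimes> s) \<le> len x" using x generate.eng generate.incl by metis
    then show "s \<in> descents x" using s TS len_mult_S_neq[OF xc, of s] by (auto simp: right_descents_def)
  qed
  note xgen = len_mult_generate_descents[OF xc this]
  have uniq: "y = inv x" if y: "y \<in> generate G T" "\<forall>z \<in> generate G T. len z \<le> len y" for y
  proof -
    have yc: "y \<in> carrier G" using generate_carrier TS y(1) by blast
    have "len y = len x" using x y by (meson antisym)
    then have "len (x \<otimes> y) = 0" using xgen[OF y(1)] by simp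
    then have "x \<otimes> y = \<one>" using xc yc by (simp add: len_eq_0)
    then show ?thesis using inv_equality[OF inv_comm] xc yc by simp
  qed
  have xinv: "inv x = x" by (rule uniq[OF x(1), symmetric]) (use x(2) in blast)
  have "longest g = x"
    unfolding longest_descent_def T_def[symmetric]
    by (rule the_equality) (use x uniq[unfolded xinv] in blast)+
  then show "longest g \<in> carrier G" "longest g \<otimes> longest g = \<one>"
    "len (g \<otimes> longest g) + len (longest g) = len g"
    using xc l_inv[OF xc] xinv gen[OF x(1)] by simp_all
qed

end

lemma edge_path_snoc:
  "edge_path A (es @ [e]) \<longleftrightarrow>
     e \<in> fsa_edges A \<and> (es = [] \<or> edge_path A es \<and> snd (last es) = fst e)"
proof (cases "es = []")
  case False
  then have "(\<forall>i. Suc i < length (es @ [e]) \<longrightarrow> snd ((es @ [e]) ! i) = fst ((es @ [e]) ! Suc i)) \<longleftrightarrow>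
    (\<forall>i. Suc i < length es \<longrightarrow> snd (es ! i) = fst (es ! Suc i)) \<and> snd (last es) = fst e"
    (is "?L \<longleftrightarrow> ?R")
  proof -
    obtain n where n: "length es = Suc n" using False by (cases es) auto
    then have "last es = es ! n" using False by (simp add: last_conv_nth)
    moreover have "?L \<longleftrightarrow> (\<forall>i \<le> n. snd ((es @ [e]) ! i) = fst ((es @ [e]) ! Suc i))"
      using n by (simp add: less_Suc_eq_le)
    moreover have "\<dots> \<longleftrightarrow> (\<forall>i < n. snd (es ! i) = fst (es ! Suc i)) \<and> snd (es ! n) = fst e"
      using n by (auto simp: nth_append le_less)
    ultimately show ?thesis using n by simp
  qed
  then show ?thesis using False by (auto simp: edge_path_def)
qed (auto simp: edge_path_def)

context coxeter
begin

section \<open>The automaton\<close>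

text \<open>Numbers the cone types, since \<open>regular_language\<close> asks for natural numbers
  as vertices.\<close>

definition index :: "'a \<Rightarrow> nat" where
  "index g = (SOME f :: 'a set \<Rightarrow> nat. inj_on f (cone ` carrier G)) (cone g)"

lemma index_eq_iff:
  assumes "g \<in> carrier G" "h \<in> carrier G"
  shows "index g = index h \<longleftrightarrow> cone g = cone h"
proof -
  have "\<exists>f :: 'a set \<Rightarrow> nat. inj_on f (cone ` carrier G)"
    using finite_imp_inj_to_nat_seg[OF finite_cones] by blast
  from inj_on_eq_iff[OF someI_ex[OF this]] show ?thesis unfolding index_def using assms by blast
qed

lemma finite_index: "finite (index ` carrier G)"
  using finite_imageI[OF finite_cones] by (simp add: index_def image_image)

text \<open>The loop at the cone type of the identity, labelled by the
  empty word, makes the automaton accept the empty word.\<close>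

definition cone_fsa :: "(nat, 'a) fsa" where
  "cone_fsa = \<lparr>
     fsa_verts = index ` carrier G,
     fsa_edges = {(index g, index (g \<otimes> w)) | g w. g \<in> carrier G \<and> w \<in> cone g \<and> longest (g \<otimes> w) = w},
     fsa_label = (\<lambda>e. {v. set v \<subseteq> S \<and> (\<exists>g \<in> carrier G. index g = snd e \<and>
        val v = longest g \<and> length v = len (longest g))}),
     fsa_start = {index \<one>},
     fsa_accept = index ` carrier G\<rparr>"

text \<open>The label of an edge refers to an arbitrary element with the index of its target; by
  this lemma the choice does not matter.\<close>

lemma longest_index:
  "g \<in> carrier G \<Longrightarrow> h \<in> carrier G \<Longrightarrow> index g = index h \<Longrightarrow> longest g = longest h"
  by (intro longest_cong) (simp add: descents_cone index_eq_iff)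

lemma is_fsa_cone_fsa: "is_fsa S cone_fsa"
proof -
  have "finite (fsa_label cone_fsa e)" for e
  proof (cases "\<exists>g \<in> carrier G. index g = snd e")
    case True
    then obtain g where g: "g \<in> carrier G" "index g = snd e" by blast
    have "fsa_label cone_fsa e \<subseteq> {v. set v \<subseteq> S \<and> length v = len (longest g)}"
    proof
      fix v assume "v \<in> fsa_label cone_fsa e"
      then obtain h where h: "h \<in> carrier G" "index h = snd e" "set v \<subseteq> S" "length v = len (longest h)"
        by (auto simp: cone_fsa_def)
      then have "longest h = longest g" using longest_index g by metis
      then show "v \<in> {v. set v \<subseteq> S \<and> length v = len (longest g)}" using h by simp
    qed
    then show ?thesis using finite_lists_length_eq[OF finite_S] finite_subset by blast
  next
    case False
    then have "fsa_label cone_fsa e = {}" by (auto simp: cone_fsa_def)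
    then show ?thesis by simp
  qed
  moreover have "w \<in> carrier G" if "w \<in> cone g" for g w using that by (simp add: cone_def)
  ultimately show ?thesis
    using finite_index by (auto simp: is_fsa_def) (auto simp: cone_fsa_def)
qed

lemma cone_fsa_edge:
  "g \<in> carrier G \<Longrightarrow> w \<in> cone g \<Longrightarrow> longest (g \<otimes> w) = w \<Longrightarrow>
    (index g, index (g \<otimes> w)) \<in> fsa_edges cone_fsa"
  by (auto simp: cone_fsa_def)

text \<open>Edges and labels are defined by some representatives of cone types;
  \<open>cone_mult\<close> transfers them to the element \<open>h\<close> that was actually
  reached.\<close>

lemma cone_fsa_step:
  assumes h: "h \<in> carrier G" and e: "(index h, j) \<in> fsa_edges cone_fsa"
    and v: "v \<in> fsa_label cone_fsa (index h, j)"
  shows "set v \<subseteq> S \<and> val v \<in> cone h \<and> index (h \<otimes> val v) = j \<and>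
    longest (h \<otimes> val v) = val v \<and> length v = len (val v)"
proof -
  obtain g w where g: "g \<in> carrier G" "w \<in> cone g" "longest (g \<otimes> w) = w"
    "index h = index g" "j = index (g \<otimes> w)"
    using e by (auto simp: cone_fsa_def)
  obtain g' where g': "g' \<in> carrier G" "index g' = j" "val v = longest g'" "length v = len (longest g')"
    and vS: "set v \<subseteq> S"
    using v by (auto simp: cone_fsa_def)
  have w: "w \<in> carrier G" using g(2) by (simp add: cone_def)
  have cone: "cone h = cone g" using index_eq_iff h g by blast
  then have "cone (h \<otimes> w) = cone (g \<otimes> w)" using cone_mult[OF h] cone_mult[OF g(1)] g(2) by simp
  then have "index (h \<otimes> w) = index (g \<otimes> w)" using index_eq_iff h g w by simp
  moreover from this have "longest (h \<otimes> w) = w" using longest_index[of "h \<otimes> w" "g \<otimes> w"] h g w by simp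
  moreover have "val v = w" using longest_index[of g' "g \<otimes> w"] g' g w by simp
  ultimately show ?thesis using g g' vS cone by auto
qed

lemma standard_language_append:
  assumes "v \<in> standard_language G S" "set v \<subseteq> S" "set u \<subseteq> S" "val u \<in> cone (val v)"
    "longest (val v \<otimes> val u) = val u" "length u = len (val u)"
  shows "v @ u \<in> standard_language G S"
proof (cases "val v \<otimes> val u = \<one>")
  \<comment> \<open>The rule \<open>step\<close> excludes the identity, but here lengths add, so
    \<open>u\<close> is empty.\<close>
  case True
  then have "len (val u) = 0" using assms(4) by (auto simp: cone_def)
  then show ?thesis using assms(1,6) by simp
next
  case False
  show ?thesis
    by (rule standard_language.step[where g = "val v \<otimes> val u" and n = "length (v @ u)" and k = "length u"])
      (use assms False in auto)
qed

lemma fsa_path_sound: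
  assumes "edge_path cone_fsa es" "fst (hd es) = index \<one>" "length vs = length es"
    "\<forall>i < length es. vs ! i \<in> fsa_label cone_fsa (es ! i)"
  shows "concat vs \<in> standard_language G S \<and> set (concat vs) \<subseteq> S \<and>
    snd (last es) = index (val (concat vs))"
  using assms
proof (induction es arbitrary: vs rule: rev_induct)
  case Nil
  then show ?case by (simp add: edge_path_def)
next
  case (snoc e es)
  obtain us v where vs: "vs = us @ [v]" using snoc.prems(3) by (cases vs rule: rev_cases) auto
  have len: "length us = length es" using snoc.prems(3) vs by simp
  have v: "v \<in> fsa_label cone_fsa e"
    using snoc.prems(4)[rule_format, of "length es"] len vs by (simp add: nth_append)
  have e: "e \<in> fsa_edges cone_fsa" using snoc.prems(1) edge_path_snoc by blast
  have pre: "concat us \<in> standard_language G S" "set (concat us) \<subseteq> S" "fst e = index (val (concat us))"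
  proof -
    have "concat us \<in> standard_language G S \<and> set (concat us) \<subseteq> S \<and> fst e = index (val (concat us))"
    proof (cases "es = []")
      case True
      then show ?thesis using len snoc.prems(2) standard_language.empty[of G S] by simp
    next
      case False
      then have "edge_path cone_fsa es" "snd (last es) = fst e" using snoc.prems(1) edge_path_snoc by blast+
      moreover have "\<forall>i < length es. us ! i \<in> fsa_label cone_fsa (es ! i)"
      proof (intro allI impI)
        fix i assume "i < length es"
        then show "us ! i \<in> fsa_label cone_fsa (es ! i)"
          using snoc.prems(4)[rule_format, of i] len vs by (simp add: nth_append)
      qed
      ultimately show ?thesis using snoc.IH[of us] snoc.prems(2) False len by simp
    qed
    then show "concat us \<in> standard_language G S" "set (concat us) \<subseteq> S" "fst e = index (val (concat us))" by auto
  qed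
  have step: "set v \<subseteq> S \<and> val v \<in> cone (val (concat us)) \<and> index (val (concat us) \<otimes> val v) = snd e \<and>
    longest (val (concat us) \<otimes> val v) = val v \<and> length v = len (val v)"
    using cone_fsa_step[of "val (concat us)" "snd e" v] e v pre by (metis prod.collapse val_closed)
  then have "concat us @ v \<in> standard_language G S"
    using standard_language_append pre by blast
  then show ?case using step pre vs by auto
qed

lemma fsa_path_complete:
  assumes "v \<in> standard_language G S"
  shows "\<exists>es vs. edge_path cone_fsa es \<and> fst (hd es) = index \<one> \<and> length vs = length es \<and>
    (\<forall>i < length es. vs ! i \<in> fsa_label cone_fsa (es ! i)) \<and> concat vs = v \<and>
    snd (last es) = index (val v) \<and> set v \<subseteq> S"
  using assms
proof induction
  case empty
  have one: "longest \<one> = \<one>"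
    using len_mult_longest[of \<one>] longest_closed[of \<one>] by (simp add: len_eq_0)
  have "(index \<one>, index \<one>) \<in> fsa_edges cone_fsa"
    using cone_fsa_edge[of \<one> \<one>] one one_in_cone[of \<one>] by simp
  moreover have "[] \<in> fsa_label cone_fsa (index \<one>, index \<one>)"
    using one by (auto simp: cone_fsa_def intro!: bexI[of _ \<one>])
  ultimately show ?case
    by (intro exI[of _ "[(index \<one>, index \<one>)]"] exI[of _ "[[]]"]) (auto simp: edge_path_def)
next
  case (step v g n k)
  define u where "u = take (n - k) v"
  define z where "z = drop (n - k) v"
  have v: "v = u @ z" by (simp add: u_def z_def)
  have vS: "set v \<subseteq> S" using step.hyps(1) by auto
  then have S: "set u \<subseteq> S" "set z \<subseteq> S" using v by auto
  have gc: "g \<in> carrier G" using step.hyps(2) vS by simp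
  have z: "val z = longest g" "length z = len (longest g)" using step.hyps by (auto simp: z_def)
  have g: "g = val u \<otimes> longest g" using step.hyps(2) v S z(1) by simp
  note lon = longest_closed[OF gc] longest_involution[OF gc] len_mult_longest[OF gc]
  \<comment> \<open>As \<open>longest g\<close> is an involution, stripping it off and appending it
    are the same multiplication, which turns the length formula into membership in the cone.\<close>
  have "g \<otimes> longest g = val u" using g lon S by (metis m_assoc r_one val_closed)
  then have cone: "longest g \<in> cone (val u)" using lon g by (simp add: cone_def)
  obtain es vs where ih: "edge_path cone_fsa es" "fst (hd es) = index \<one>" "length vs = length es"
    "\<forall>i < length es. vs ! i \<in> fsa_label cone_fsa (es ! i)" "concat vs = u" "snd (last es) = index (val u)"
    using step.IH unfolding u_def by blast
  have "(index (val u), index g) \<in> fsa_edges cone_fsa"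
    using cone_fsa_edge[of "val u" "longest g"] cone S unfolding g[symmetric] by simp
  then have "edge_path cone_fsa (es @ [(index (val u), index g)])" using ih by (simp add: edge_path_snoc)
  moreover have "z \<in> fsa_label cone_fsa (index (val u), index g)"
    using S z gc by (auto simp: cone_fsa_def)
  then have "\<forall>i < length (es @ [(index (val u), index g)]).
      (vs @ [z]) ! i \<in> fsa_label cone_fsa ((es @ [(index (val u), index g)]) ! i)"
    using ih by (auto simp: nth_append less_Suc_eq)
  moreover have "es \<noteq> []" using ih(1) by (simp add: edge_path_def)
  ultimately show ?case
    using ih v vS step.hyps(2)
    by (intro exI[of _ "es @ [(index (val u), index g)]"] exI[of _ "vs @ [z]"]) auto
qed

lemma standard_language_eq_fsa_language: "standard_language G S = fsa_language cone_fsa"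
proof (intro equalityI subsetI)
  fix v assume "v \<in> standard_language G S"
  then obtain es vs where p: "edge_path cone_fsa es" "fst (hd es) = index \<one>" "length vs = length es"
    "\<forall>i < length es. vs ! i \<in> fsa_label cone_fsa (es ! i)" "concat vs = v"
    "snd (last es) = index (val v)" "set v \<subseteq> S"
    using fsa_path_complete by blast
  then have "snd (last es) \<in> fsa_accept cone_fsa" "fst (hd es) \<in> fsa_start cone_fsa"
    by (auto simp: cone_fsa_def)
  then show "v \<in> fsa_language cone_fsa" unfolding fsa_language_def using p by blast
next
  fix v assume "v \<in> fsa_language cone_fsa"
  then obtain es vs where "v = concat vs" "edge_path cone_fsa es" "fst (hd es) \<in> fsa_start cone_fsa"
    "length vs = length es" "\<forall>i < length es. vs ! i \<in> fsa_label cone_fsa (es ! i)"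
    unfolding fsa_language_def by blast
  then show "v \<in> standard_language G S" using fsa_path_sound[of es vs] by (simp add: cone_fsa_def)
qed

end

theorem theorem1p3:
  fixes G :: "('a, 'b) monoid_scheme" and S :: "'a set" and m :: "'a \<Rightarrow> 'a \<Rightarrow> enat"
  assumes "coxeter_system G S m"
  shows "regular_language S (standard_language G S)"
proof -
  interpret coxeter G S m using assms by unfold_locales
  show ?thesis
    unfolding regular_language_def
    using is_fsa_cone_fsa standard_language_eq_fsa_language by blast
qed

end
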